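(* (i) Let $0<q<1$ and $z\in\mathbb{C}\setminus\{0\}$. For $n\in\mathbb{N}$ define $e(n)$ by $$S_n(zq^{-n};q)=\frac{(-z)^{\lfloor n/2\rfloor}\left\{\theta_4(z^{-1}q^{\chi(n)};q)+e(n)\right\}}{(q;q)_\infty^2\,q^{\lfloor n/2\rfloor\lfloor(n+1)/2\rfloor}}.$$ Then for all sufficiently large $n$, $$|e(n)|\le 12\,\theta_3\left(|z|^{-1}q^{\chi(n)};q\right)\left\{\frac{q^{n/4}}{1-q}+|z|^{\lfloor n/4\rfloor}q^{\lfloor n/4\rfloor^2-\chi(n)\lfloor n/4\rfloor}+\frac{q^{\lfloor n/4\rfloor^2+\chi(n)\lfloor n/4\rfloor}}{|z|^{\lfloor n/4\rfloor}}\right\}.$$ (ii) Let $0<a<\frac12$ and $u\in\mathbb{R}$ be fixed, and let $n\in\mathbb{N}$. Then, as $n\to\infty$, $$S_n\left(-\exp\left(2\pi n^{-a}(n^a u+n)\right);\exp(-2\pi n^{-a})\right)=\frac{\exp\left\{\pi n^{-a}(n^a u+n)^2/2\right\}\left\{1+\mathcal{O}\left(e^{-\pi n^a/2}\right)\right\}}{\sqrt{2n^a}\,\exp\left\{\pi n^{-a}/6-\pi n^a/6\right\}},$$ $$S_n\left(\exp\left(2\pi n^{-a}(n^a u+n)\right);\exp(-2\pi n^{-a})\right)=\sqrt{\frac{2}{n^a}}\;\frac{\exp\left\{\frac{\pi n^{-a}}{2}(n^a u+n)^2\right\}\left\{\cos\frac{\pi}{2}(n^a u+n)+\mathcal{O}\left(e^{-\pi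 n^a}\right)\right\}}{\exp\left\{\pi n^{-a}/6-\pi n^a/24\right\}},$$ and consequently $$s_n\left(\exp\left(2\pi n^{-a}(n^a u+n)\right);\exp(-2\pi n^{-a})\right)=\frac{\exp(-\pi u/2)\left\{\cos\frac{\pi}{2}(n^a u+n)+\mathcal{O}\left(e^{-\pi n^a}\right)\right\}}{\sqrt{\pi}\,\exp\left(3\pi n^{1-a}/2+\pi n^{-a}/4\right)}.$$
   Context: For $0<q<1$: $(c;q)_\infty=\prod_{k=0}^\infty(1-cq^k)$, $(c;q)_k=\prod_{j=0}^{k-1}(1-cq^j)$. The Stieltjes-Wigert polynomials are $S_n(x;q)=\sum_{k=0}^n\frac{q^{k^2}(-x)^k}{(q;q)_k(q;q)_{n-k}}$. Put $$w_{sw}(x)=\sqrt{\frac{-1}{2\pi\log q}}\exp\left(\frac{1}{2\log q}\left[\log\left(\frac{x}{\sqrt q}\right)\right]^2\right),\quad x>0,$$ and $s_n(x;q)=\sqrt{q^n(q;q)_n\,w_{sw}(x)}\;S_n(x;q)$ for $x>0$ (with the same $q$ in $w_{sw}$). The theta functions are $\theta_3(z;q)=\sum_{k=-\infty}^\infty q^{k^2}z^k$ and $\theta_4(z;q)=\sum_{k=-\infty}^\infty(-1)^kq^{k^2}z^k$ for $z\in\mathbb{C}\setminus\{0\}$. $\lfloor x\rfloor$ is the greatest integer $\le x$, and $\chi(n)=n-2\lfloor n/2\rfloor$ ($0$ for $n$ even, $1$ for $n$ odd). In (i) "sufficiently large" may depend on $q,z$. In (ii) the $\mathcal{O}$ terms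 are as $n\to\infty$ with $a,u$ fixed (implied constants may depend on $a,u$). *)

theory Defs
  imports "HOL-Analysis.Analysis" "HOL-Library.Landau_Symbols"
begin

text \<open>Throughout, the base \<open>q\<close> is real and is meant to satisfy \<open>0 < q < 1\<close>.
  The functions of \<open>x\<close> and \<open>z\<close> are polymorphic so that they can be
  used at both real and complex arguments.\<close>

definition qpoch :: "real \<Rightarrow> real \<Rightarrow> nat \<Rightarrow> real" where
  "qpoch c q k = (\<Prod>j<k. 1 - c * q ^ j)"

definition qpoch_inf :: "real \<Rightarrow> real \<Rightarrow> real" where
  "qpoch_inf c q = (\<Prod>k. 1 - c * q ^ k)"

definition SW :: "nat \<Rightarrow> 'a::real_normed_field \<Rightarrow> real \<Rightarrow> 'a" where
  "SW n x q =
     (\<Sum>k\<le>n. of_real (q ^ (k\<^sup>2)) * (- x) ^ k / of_real (qpoch q q k * qpoch q q (n - k)))"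

definition w_sw :: "real \<Rightarrow> real \<Rightarrow> real" where
  "w_sw x q = sqrt (- 1 / (2 * pi * ln q)) * exp (1 / (2 * ln q) * (ln (x / sqrt q))\<^sup>2)"

definition sw_fun :: "nat \<Rightarrow> real \<Rightarrow> real \<Rightarrow> real" where
  "sw_fun n x q = sqrt (q ^ n * qpoch q q n * w_sw x q) * SW n x q"

definition theta3 :: "'a::real_normed_field \<Rightarrow> real \<Rightarrow> 'a" where
  "theta3 z q = (\<Sum>\<^sub>\<infinity>k::int. of_real (q powi (k\<^sup>2)) * z powi k)"

definition theta4 :: "'a::real_normed_field \<Rightarrow> real \<Rightarrow> 'a" where
  "theta4 z q = (\<Sum>\<^sub>\<infinity>k::int. (- 1) powi k * of_real (q powi (k\<^sup>2)) * z powi k)"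

definition chi :: "nat \<Rightarrow> nat" where
  "chi n = n - 2 * (n div 2)"

end

theory Submission
  imports Defs "HOL-Probability.Probability" "HOL-Real_Asymp.Real_Asymp"
begin

text \<open>Recentring the sum defining \<open>S\<^sub>n(z q\<^sup>-\<^sup>n; q)\<close> at \<open>n div 2\<close> turns its terms into the terms of a theta
  series times a weight in \<open>[0, 1]\<close>. The weight is close to 1 in the middle range, and outside
  of it the terms are dominated by a shifted copy of the theta series; this bounds the error
  uniformly in \<open>q\<close>, \<open>z\<close> and \<open>n\<close>. When \<open>q = exp (- 2 * pi * t)\<close> with \<open>t = n powr - a\<close>, the bound is
  still exponentially small, and both the theta functions and \<open>(q;q)\<^sub>\<infinity>\<close> have to be evaluated as
  \<open>t\<close> tends to 0. By the pentagonal number theorem \<open>(q;q)\<^sub>\<infinity>\<close> is, like the theta functions, a sum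
  of (alternating) Gaussians over the integers, and Poisson summation converts all of these
  into series dominated by their first term.\<close>

subsection \<open>Poisson summation for Gaussians\<close>

text \<open>The obstacle in (ii) is a difference in size. The alternating theta function is smaller
  than \<open>theta3\<close> by a factor of order \<open>exp (- pi * n powr a / 8)\<close>, while
  the error of the recentred sum can only be measured against \<open>theta3\<close>. The error
  factor therefore has to beat this loss and still leave \<open>exp (- pi * n powr a)\<close>. It is
  shown to be of order \<open>exp (- 2 * pi * n powr a)\<close>, and the critical part is q ^ (n /
  4) = exp (- pi * n powr (1 - a) / 2): here \<open>a < 1 / 2\<close> enters. Since the cosine can
  vanish, its error is kept additive throughout. The product (q;q)_inf occurs squared in the
  denominator and is itself exponentially small, so it must be known to the same relative accuracy.
  Its exponents 3 k^2 + k are 3 (k + 1/6)^2 - 1/12, which explains the shift 1/6. At this shift the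
  second Fourier coefficient is cos (pi / 2) = 0; without this the relative error would be only exp
  (- 2 pi / (3 t)) instead of exp (- pi / t). Poisson summation goes through the Dirichlet kernel
  because a derivative bound then gives a majorant that does not depend on the order of the
  kernel.\<close>

lemma has_sum_int_imp_sums:
  fixes g :: "int \<Rightarrow> 'a :: real_normed_vector"
  assumes "(g has_sum S) UNIV"
  shows "(\<lambda>k. if k = 0 then g 0 else g (int k) + g (- int k)) sums S"
proof -
  have part: "(\<Sum>k<Suc K. if k = 0 then g 0 else g (int k) + g (- int k)) = sum g {- int K..int K}" for K
  proof (induction K)
    case (Suc K)
    have "{- int (Suc K)..int (Suc K)} = insert (int (Suc K)) (insert (- int (Suc K)) {- int K..int K})"
      by auto
    then show ?case using Suc by (simp add: add_ac)
  qed simp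
  \<comment> \<open>The symmetric intervals are cofinal among the finite sets of integers, so
    unordered summation specialises to them.\<close>
  have "filterlim (\<lambda>K. {- int K..int K}) (finite_subsets_at_top UNIV) sequentially"
    unfolding filterlim_finite_subsets_at_top
  proof (intro allI impI, elim conjE)
    fix X :: "int set" assume "finite X"
    have "\<forall>x\<in>X. nat \<bar>x\<bar> \<le> Max (insert 0 ((\<lambda>x. nat \<bar>x\<bar>) ` X))"
      using \<open>finite X\<close> by (auto intro!: Max_ge)
    then have "\<forall>K\<ge>Max (insert 0 ((\<lambda>x. nat \<bar>x\<bar>) ` X)). X \<subseteq> {- int K..int K}"
      by (auto simp: Ball_def) (smt (verit) int_nat_eq le_trans nat_le_iff)+
    then show "\<forall>\<^sub>F K in sequentially. finite {- int K..int K} \<and> X \<subseteq> {- int K..int K} \<and> {- int K..int K} \<subseteq> UNIV"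
      by (auto simp: eventually_sequentially)
  qed
  then have "(\<lambda>K. sum g {- int K..int K}) \<longlonglongrightarrow> S"
    using assms unfolding has_sum_def by (rule filterlim_compose[rotated])
  then show ?thesis
    unfolding sums_def part[symmetric] by (rule LIMSEQ_imp_Suc)
qed

section \<open>The Dirichlet kernel of period 1\<close>

definition dirichlet :: "nat \<Rightarrow> real \<Rightarrow> real" where
  "dirichlet J y = 1 + 2 * (\<Sum>j=1..J. cos (2 * pi * real j * y))"

text \<open>Multiplication by the sine makes the cosine sum telescope. The closed form is kept as a
  product, so \<open>y = 0\<close> needs no exception.\<close>

lemma sin_mult_dirichlet: "sin (pi * y) * dirichlet J y = sin ((2 * real J + 1) * pi * y)"
proof (induction J)
  case (Suc J)
  have "2 * (sin (pi * y) * cos (2 * pi * real (Suc J) * y)) =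
      sin ((2 * real (Suc J) + 1) * pi * y) - sin ((2 * real J + 1) * pi * y)"
  proof -
    have d: "((2 * real (Suc J) + 1) * pi * y - (2 * real J + 1) * pi * y) / 2 = pi * y"
      and s: "((2 * real (Suc J) + 1) * pi * y + (2 * real J + 1) * pi * y) / 2 = 2 * pi * real (Suc J) * y"
      by (simp_all add: field_simps)
    show ?thesis unfolding sin_diff_sin d s by simp
  qed
  then show ?case using Suc by (simp add: dirichlet_def algebra_simps)
qed (simp add: dirichlet_def)

lemma dirichlet_add_int: "dirichlet J (y + real_of_int k) = dirichlet J y"
proof -
  have "cos (2 * pi * real j * (y + real_of_int k)) = cos (2 * pi * real j * y)" for j
  proof -
    have "2 * pi * real j * (y + real_of_int k) = 2 * pi * real j * y + 2 * pi * real_of_int (int j * k)"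
      by (simp add: algebra_simps)
    then show ?thesis
      by (simp add: cos_add cos_int_2pin sin_int_2pin del: of_int_mult)
  qed
  then show ?thesis by (simp add: dirichlet_def)
qed

lemma continuous_on_dirichlet [continuous_intros]: "continuous_on A (dirichlet J)"
  unfolding dirichlet_def by (intro continuous_intros)

lemma borel_measurable_dirichlet [measurable]: "dirichlet J \<in> borel_measurable borel"
  by (intro borel_measurable_continuous_onI continuous_intros)

lemma has_integral_cos_period:
  fixes m :: int
  shows "((\<lambda>y. cos (2 * pi * real_of_int m * y)) has_integral (if m = 0 then 1 else 0)) {-1/2..1/2::real}"
proof (cases "m = 0")
  case True
  then show ?thesis using has_integral_const_real[of "1::real" "-1/2" "1/2"] by simp
next
  case False
  have "((\<lambda>y. cos (2 * pi * real_of_int m * y)) has_integral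
     (sin (2 * pi * real_of_int m * (1/2)) / (2 * pi * real_of_int m)
      - sin (2 * pi * real_of_int m * (-1/2)) / (2 * pi * real_of_int m))) {-1/2..1/2::real}"
    by (rule fundamental_theorem_of_calculus)
      (use False in \<open>auto intro!: derivative_eq_intros simp flip: has_real_derivative_iff_has_vector_derivative\<close>)
  moreover have "sin (pi * real_of_int m) = 0" by (simp add: sin_zero_iff_int2)
  ultimately show ?thesis using False by simp
qed

lemma has_integral_dirichlet: "(dirichlet J has_integral 1) {-1/2..1/2}"
proof -
  have "((\<lambda>y. cos (2 * pi * real_of_int 0 * y) + 2 * (\<Sum>j=1..J. cos (2 * pi * real_of_int (int j) * y)))
     has_integral (1 + 2 * (\<Sum>j=1..J. if int j = 0 then 1 else 0))) {-1/2..1/2::real}"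
    by (intro has_integral_add has_integral_mult_right has_integral_sum has_integral_cos_period
      has_integral_cos_period[of 0, simplified if_True refl]) auto
  then show ?thesis unfolding dirichlet_def[abs_def] by (simp cong: sum.cong)
qed

text \<open>These are the sines of \<open>sin_mult_dirichlet\<close>. They have half-integer
  frequencies, but a product of two of them has the integer frequencies J - L and J + L + 1. The
  latter is never 0, so only J = L contributes.\<close>

lemma integral_sin_sin:
  "((\<lambda>y. sin ((2 * real J + 1) * pi * y) * sin ((2 * real L + 1) * pi * y))
     has_integral (if J = L then 1/2 else 0)) {-1/2..1/2::real}"
proof -
  have *: "sin ((2 * real J + 1) * pi * y) * sin ((2 * real L + 1) * pi * y) =
    1/2 * cos (2 * pi * real_of_int (int J - int L) * y)
    - 1/2 * cos (2 * pi * real_of_int (int J + int L + 1) * y)" for y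
  proof -
    have d: "(2 * real J + 1) * pi * y - (2 * real L + 1) * pi * y = 2 * pi * real_of_int (int J - int L) * y"
      and s: "(2 * real J + 1) * pi * y + (2 * real L + 1) * pi * y = 2 * pi * real_of_int (int J + int L + 1) * y"
      by (simp_all add: algebra_simps)
    show ?thesis unfolding sin_times_sin d s by simp
  qed
  have "((\<lambda>y. 1/2 * cos (2 * pi * real_of_int (int J - int L) * y)
    - 1/2 * cos (2 * pi * real_of_int (int J + int L + 1) * y)) has_integral
      (1/2 * (if int J - int L = 0 then 1 else 0) - 1/2 * (if int J + int L + 1 = 0 then 1 else 0))) {-1/2..1/2}"
    by (intro has_integral_diff has_integral_mult_right has_integral_cos_period)
  moreover have "(1/2 * (if int J - int L = 0 then 1 else 0) - 1/2 * (if int J + int L + 1 = 0 then 1 else 0))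
     = (if J = L then 1/2 else 0 :: real)" by simp
  ultimately show ?thesis unfolding * by simp
qed

text \<open>Bessel's inequality makes the coefficients square summable.\<close>

lemma riemann_lebesgue_sin:
  fixes g :: "real \<Rightarrow> real"
  assumes cont: "continuous_on {-1/2..1/2} g"
  shows "(\<lambda>J. integral {-1/2..1/2} (\<lambda>y. g y * sin ((2 * real J + 1) * pi * y))) \<longlonglongrightarrow> 0"
proof -
  define S where "S = (\<lambda>J y. sin ((2 * real J + 1) * pi * y))"
  define b where "b = (\<lambda>J. integral {-1/2..1/2} (\<lambda>y. g y * S J y))"
  have contS: "continuous_on {-1/2..1/2} (S J)" for J
    unfolding S_def by (intro continuous_intros)
  have b: "((\<lambda>y. g y * S J y) has_integral b J) {-1/2..1/2}" for J
    unfolding b_def by (intro integrable_integral integrable_continuous_interval continuous_intros cont contS)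
  have SS: "((\<lambda>y. S J y * S L y) has_integral (if J = L then 1/2 else 0)) {-1/2..1/2}" for J L
    unfolding S_def by (rule integral_sin_sin)
  define G where "G = integral {-1/2..1/2} (\<lambda>y. g y * g y)"
  have G: "((\<lambda>y. g y * g y) has_integral G) {-1/2..1/2}"
    unfolding G_def by (intro integrable_integral integrable_continuous_interval continuous_intros cont)
  have bessel: "(\<Sum>J<M. (b J)\<^sup>2) \<le> G / 2" for M
  proof -
    \<comment> \<open>The orthogonal projection of \<open>g\<close> to the first \<open>M\<close>
      sines: each has squared norm 1/2, so its coefficient is \<open>b J / (1/2)\<close>.
      Integrating the nonnegative (g - P)^2 yields the inequality.\<close>
    define P where "P = (\<lambda>y. \<Sum>J<M. 2 * b J * S J y)"
    have gP: "((\<lambda>y. \<Sum>J<M. 2 * b J * (g y * S J y)) has_integral (\<Sum>J<M. 2 * b J * b J)) {-1/2..1/2}"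
      by (intro has_integral_sum has_integral_mult_right b) auto
    have PP: "((\<lambda>y. \<Sum>J<M. \<Sum>L<M. 4 * b J * b L * (S J y * S L y)) has_integral
        (\<Sum>J<M. \<Sum>L<M. 4 * b J * b L * (if J = L then 1/2 else 0))) {-1/2..1/2}"
      by (intro has_integral_sum has_integral_mult_right SS) auto
    have val: "(\<Sum>J<M. \<Sum>L<M. 4 * b J * b L * (if J = L then 1/2 else 0)) = (\<Sum>J<M. 2 * (b J)\<^sup>2)"
      by (intro sum.cong refl) (simp add: if_distrib[of "\<lambda>x. _ * x"] sum.delta' power2_eq_square cong: if_cong)
    have "((\<lambda>y. g y * g y - 2 * (\<Sum>J<M. 2 * b J * (g y * S J y)) + (\<Sum>J<M. \<Sum>L<M. 4 * b J * b L * (S J y * S L y)))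
       has_integral (G - 2 * (\<Sum>J<M. 2 * b J * b J) + (\<Sum>J<M. \<Sum>L<M. 4 * b J * b L * (if J = L then 1/2 else 0)))) {-1/2..1/2}"
      by (intro has_integral_diff has_integral_add has_integral_mult_right G gP PP)
    moreover have "g y * g y - 2 * (\<Sum>J<M. 2 * b J * (g y * S J y)) + (\<Sum>J<M. \<Sum>L<M. 4 * b J * b L * (S J y * S L y))
       = (g y - P y)\<^sup>2" for y
    proof -
      have 1: "(\<Sum>J<M. 2 * b J * (g y * S J y)) = g y * P y"
        by (simp add: P_def sum_distrib_left mult_ac)
      have 2: "(\<Sum>J<M. \<Sum>L<M. 4 * b J * b L * (S J y * S L y)) = P y * P y"
        unfolding P_def sum_product by (intro sum.cong refl) simp
      show ?thesis unfolding 1 2 by (simp add: power2_eq_square algebra_simps)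
    qed
    ultimately have "((\<lambda>y. (g y - P y)\<^sup>2) has_integral
        (G - 2 * (\<Sum>J<M. 2 * b J * b J) + (\<Sum>J<M. 2 * (b J)\<^sup>2))) {-1/2..1/2}"
      unfolding val by simp
    then have "0 \<le> G - 2 * (\<Sum>J<M. 2 * b J * b J) + (\<Sum>J<M. 2 * (b J)\<^sup>2)"
      by (rule has_integral_nonneg) auto
    then show ?thesis by (simp add: power2_eq_square mult.assoc flip: sum_distrib_left)
  qed
  have "summable (\<lambda>J. (b J)\<^sup>2)"
    by (rule bounded_imp_summable[where B = "G/2"])
      (use bessel[of "Suc _"] in \<open>auto simp: lessThan_Suc_atMost\<close>)
  then have "(\<lambda>J. (b J)\<^sup>2) \<longlonglongrightarrow> 0" by (rule summable_LIMSEQ_zero)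
  then have "(\<lambda>J. sqrt ((b J)\<^sup>2)) \<longlonglongrightarrow> sqrt 0" by (rule tendsto_real_sqrt)
  then have "b \<longlonglongrightarrow> 0" by (simp add: tendsto_rabs_zero_iff)
  then show ?thesis by (simp add: b_def S_def)
qed

text \<open>A removable singularity: continuity at 0 is the definition of the derivative. It serves
  both for sin (pi y) / y and for the quotient that enters the Dirichlet integrals.\<close>

lemma difference_quotient_continuous:
  fixes \<phi> \<phi>' :: "real \<Rightarrow> real"
  assumes "\<And>y. (\<phi> has_real_derivative \<phi>' y) (at y)"
  shows "continuous_on A (\<lambda>y. if y = 0 then \<phi>' 0 else (\<phi> y - \<phi> 0) / y)"
proof -
  have "isCont (\<lambda>y. if y = 0 then \<phi>' 0 else (\<phi> y - \<phi> 0) / y) a" for a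
  proof (cases "a = 0")
    case True
    have "(\<lambda>y. (\<phi> y - \<phi> 0) / y) \<midarrow>0\<rightarrow> \<phi>' 0"
      using assms[of 0] by (simp add: has_field_derivative_iff)
    then have "(\<lambda>y. if y = 0 then \<phi>' 0 else (\<phi> y - \<phi> 0) / y) \<midarrow>0\<rightarrow> \<phi>' 0"
      by (rule Lim_transform_eventually) (auto simp: eventually_at_filter)
    then show ?thesis using True by (simp add: isCont_def)
  next
    case False
    have "isCont (\<lambda>y. (\<phi> y - \<phi> 0) / y) a"
      using False DERIV_isCont[OF assms] by (intro continuous_intros) auto
    moreover have "\<forall>\<^sub>F y in nhds a. (if y = 0 then \<phi>' 0 else (\<phi> y - \<phi> 0) / y) = (\<phi> y - \<phi> 0) / y"
      using t1_space_nhds[OF False] by eventually_elim auto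
    ultimately show ?thesis by (simp add: isCont_cong)
  qed
  then show ?thesis by (simp add: continuous_at_imp_continuous_on)
qed

text \<open>1 / sin (pi y) with its pole at 0 cancelled by the factor \<open>y\<close>; the value at
  0 is the limit, so the function is continuous on the period interval.\<close>

definition sin_ratio :: "real \<Rightarrow> real" where
  "sin_ratio y = (if y = 0 then 1 / pi else y / sin (pi * y))"

lemma sin_pi_nonzero:
  assumes "y \<in> {-1/2..1/2::real}" "y \<noteq> 0"
  shows "sin (pi * y) \<noteq> 0"
proof
  assume "sin (pi * y) = 0"
  then obtain i :: int where "pi * y = of_int i * pi" by (auto simp: sin_zero_iff_int2)
  then have "y = of_int i" by simp
  then show False using assms by auto
qed

lemma continuous_on_sin_ratio: "continuous_on {-1/2..1/2} sin_ratio"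
proof -
  have "continuous_on {-1/2..1/2} (\<lambda>y. if y = 0 then pi * cos (pi * 0) else (sin (pi * y) - sin (pi * 0)) / y)"
    by (rule difference_quotient_continuous[where \<phi>' = "\<lambda>y. pi * cos (pi * y)"]) (auto intro!: derivative_eq_intros)
  then have "continuous_on {-1/2..1/2} (\<lambda>y. inverse (if y = 0 then pi * cos (pi * 0) else (sin (pi * y) - sin (pi * 0)) / y))"
    by (intro continuous_intros) (use sin_pi_nonzero in auto)
  also have "(\<lambda>y. inverse (if y = 0 then pi * cos (pi * 0) else (sin (pi * y) - sin (pi * 0)) / y)) = sin_ratio"
    by (auto simp: sin_ratio_def fun_eq_iff inverse_eq_divide)
  finally show ?thesis .
qed

text \<open>Write \<phi> y = \<phi> 0 + y * d y. The constant part gives \<phi> 0 because the kernel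
  has mass 1. In the rest, \<open>sin_ratio\<close> trades the factor \<open>y\<close> for sin (pi
  y), which turns the kernel into a pure sine, and Riemann-Lebesgue applies. The second claim is
  uniform in \<open>J\<close>, as dominated summation over the unit intervals requires.\<close>

lemma dirichlet_kernel_integral:
  fixes \<phi> \<phi>' :: "real \<Rightarrow> real"
  assumes der: "\<And>y. (\<phi> has_real_derivative \<phi>' y) (at y)"
    and bound: "\<And>y. y \<in> {-1/2..1/2} \<Longrightarrow> \<bar>\<phi>' y\<bar> \<le> M"
    and K: "\<And>y. y \<in> {-1/2..1/2} \<Longrightarrow> \<bar>sin_ratio y\<bar> \<le> K"
  shows "(\<lambda>J. integral {-1/2..1/2} (\<lambda>y. \<phi> y * dirichlet J y)) \<longlonglongrightarrow> \<phi> 0"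
    and "\<bar>integral {-1/2..1/2} (\<lambda>y. \<phi> y * dirichlet J y) - \<phi> 0\<bar> \<le> M * K"
proof -
  define d where "d = (\<lambda>y. if y = 0 then \<phi>' 0 else (\<phi> y - \<phi> 0) / y)"
  define g where "g = (\<lambda>y. d y * sin_ratio y)"
  have contd: "continuous_on {-1/2..1/2} d"
    unfolding d_def by (rule difference_quotient_continuous[OF der])
  have contg: "continuous_on {-1/2..1/2} g"
    unfolding g_def by (intro continuous_intros contd continuous_on_sin_ratio)
  have dM: "\<bar>d y\<bar> \<le> M" if y: "y \<in> {-1/2..1/2}" for y
  proof (cases "y = 0")
    case True
    then show ?thesis using bound[of 0] by (simp add: d_def)
  next
    case False
    obtain z where z: "z \<in> {-1/2..1/2}" "\<phi> y - \<phi> 0 = y * \<phi>' z"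
    proof (cases "y > 0")
      case True
      obtain z where "0 < z" "z < y" "\<phi> y - \<phi> 0 = (y - 0) * \<phi>' z"
        using MVT2[OF True, of \<phi> \<phi>'] der by blast
      then show ?thesis using that[of z] y by auto
    next
      case False
      with \<open>y \<noteq> 0\<close> have "y < 0" by simp
      obtain z where "y < z" "z < 0" "\<phi> 0 - \<phi> y = (0 - y) * \<phi>' z"
        using MVT2[OF \<open>y < 0\<close>, of \<phi> \<phi>'] der by blast
      then show ?thesis using that[of z] y by auto
    qed
    then show ?thesis using False bound[OF z(1)] by (simp add: d_def)
  qed
  have gM: "\<bar>g y\<bar> \<le> M * K" if y: "y \<in> {-1/2..1/2}" for y
    unfolding g_def abs_mult using dM[OF y] K[OF y] by (intro mult_mono) auto
  have eq: "\<phi> y * dirichlet J y = \<phi> 0 * dirichlet J y + g y * sin ((2 * real J + 1) * pi * y)"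
    if y: "y \<in> {-1/2..1/2}" for y J
  proof (cases "y = 0")
    case False
    have "(\<phi> y - \<phi> 0) * dirichlet J y = g y * (sin (pi * y) * dirichlet J y)"
      using sin_pi_nonzero[OF y False] False by (simp add: g_def d_def sin_ratio_def)
    then show ?thesis by (simp only: sin_mult_dirichlet) (simp add: algebra_simps)
  qed (simp del: minus_divide_left)
  have int: "((\<lambda>y. \<phi> y * dirichlet J y) has_integral
      (\<phi> 0 + integral {-1/2..1/2} (\<lambda>y. g y * sin ((2 * real J + 1) * pi * y)))) {-1/2..1/2}" for J
  proof -
    have "((\<lambda>y. \<phi> 0 * dirichlet J y + g y * sin ((2 * real J + 1) * pi * y)) has_integral
      (\<phi> 0 * 1 + integral {-1/2..1/2} (\<lambda>y. g y * sin ((2 * real J + 1) * pi * y)))) {-1/2..1/2}"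
      by (intro has_integral_add has_integral_mult_right has_integral_dirichlet integrable_integral
          integrable_continuous_interval continuous_intros contg)
    then show ?thesis
      by (simp only: mult_1_right) (rule has_integral_eq[rotated], auto simp: eq)
  qed
  have I: "integral {-1/2..1/2} (\<lambda>y. \<phi> y * dirichlet J y) =
     \<phi> 0 + integral {-1/2..1/2} (\<lambda>y. g y * sin ((2 * real J + 1) * pi * y))" for J
    by (rule integral_unique[OF int])
  show "(\<lambda>J. integral {-1/2..1/2} (\<lambda>y. \<phi> y * dirichlet J y)) \<longlonglongrightarrow> \<phi> 0"
    unfolding I using tendsto_add[OF tendsto_const riemann_lebesgue_sin[OF contg]] by simp
  have "norm (integral {-1/2..1/2} (\<lambda>y. g y * sin ((2 * real J + 1) * pi * y))) \<le> M * K * (1/2 - (-1/2))"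
  proof (rule integral_bound)
    fix y :: real assume y: "y \<in> {-1/2..1/2}"
    have "\<bar>g y\<bar> * \<bar>sin ((2 * real J + 1) * pi * y)\<bar> \<le> (M * K) * 1"
      using gM[OF y] by (intro mult_mono) auto
    then show "norm (g y * sin ((2 * real J + 1) * pi * y)) \<le> M * K" by (simp add: abs_mult)
  qed (use contg in \<open>auto intro!: continuous_intros\<close>)
  then show "\<bar>integral {-1/2..1/2} (\<lambda>y. \<phi> y * dirichlet J y) - \<phi> 0\<bar> \<le> M * K"
    unfolding I by simp
qed

section \<open>Unfolding sums and integrals over the line\<close>

lemma summable_on_int:
  fixes g :: "int \<Rightarrow> 'a :: banach"
  assumes "summable (\<lambda>n. norm (g (int n)))" "summable (\<lambda>n. norm (g (- int n)))"
  shows "g summable_on UNIV"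
proof -
  have "g summable_on (int ` UNIV)"
    using norm_summable_imp_summable_on[OF assms(1)] by (simp add: summable_on_reindex o_def)
  moreover have "g summable_on (range (\<lambda>n. - int (Suc n)))"
  proof -
    have "summable (\<lambda>n. norm (g (- int (Suc n))))"
      using assms(2) by (subst summable_Suc_iff[where f = "\<lambda>n. norm (g (- int n))"])
    from norm_summable_imp_summable_on[OF this] show ?thesis
      by (subst summable_on_reindex) (auto simp: inj_on_def o_def)
  qed
  moreover have "range int \<inter> range (\<lambda>n. - int (Suc n)) = {}" by auto
  ultimately have "g summable_on (range int \<union> range (\<lambda>n. - int (Suc n)))"
    by (rule summable_on_Un_disjoint)
  also have "range int \<union> range (\<lambda>n. - int (Suc n)) = UNIV"
  proof -
    have "k \<in> range int \<union> range (\<lambda>n. - int (Suc n))" for k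
      by (cases k rule: int_cases) (auto simp del: of_nat_Suc)
    then show ?thesis by blast
  qed
  finally show ?thesis .
qed

lemma summable_exp_minus: "summable (\<lambda>n. exp (- real n))"
proof -
  have "summable (\<lambda>n. exp (- 1 :: real) ^ n)" by (rule summable_geometric) simp
  then show ?thesis by (simp add: exp_of_nat_mult[symmetric])
qed

text \<open>Shifts of the central interval by the integers from -K to K tile the symmetric interval.
  Grouping k with -k matches \<open>has_sum_int_imp_sums\<close>, so the integral and the sum over
  the integers become series of the same shape.\<close>

lemma integral_unit_intervals:
  fixes h :: "real \<Rightarrow> real"
  assumes "continuous_on UNIV h"
  shows "(\<Sum>k<Suc K. if k = 0 then integral {-1/2..1/2} h
           else integral {-1/2..1/2} (\<lambda>y. h (y + real k)) + integral {-1/2..1/2} (\<lambda>y. h (y - real k)))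
         = integral {- real K - 1/2..real K + 1/2} h"
proof (induction K)
  case (Suc K)
  have int: "h integrable_on {a..b}" for a b
    by (intro integrable_continuous_interval continuous_on_subset[OF assms]) auto
  have shift: "integral {-1/2..1/2} (\<lambda>y. h (y + c)) = integral {-1/2 + c..1/2 + c} h" for c
    using integral_shift[of "-1/2" c "1/2" h] continuous_on_subset[OF assms] by (simp add: o_def)
  have bounds: "-1/2 + real (Suc K) = real K + 1/2" "1/2 + real (Suc K) = real (Suc K) + 1/2"
    "-1/2 + - real (Suc K) = - real (Suc K) - 1/2" "1/2 + - real (Suc K) = - real K - 1/2"
    by simp_all
  have "integral {- real (Suc K) - 1/2..real (Suc K) + 1/2} h =
    integral {- real (Suc K) - 1/2..- real K - 1/2} h + integral {- real K - 1/2..real (Suc K) + 1/2} h"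
    by (rule Henstock_Kurzweil_Integration.integral_combine[symmetric]) (auto intro: int)
  also have "integral {- real K - 1/2..real (Suc K) + 1/2} h =
     integral {- real K - 1/2..real K + 1/2} h + integral {real K + 1/2..real (Suc K) + 1/2} h"
    by (rule Henstock_Kurzweil_Integration.integral_combine[symmetric]) (auto intro: int)
  finally have "integral {- real (Suc K) - 1/2..real (Suc K) + 1/2} h =
      integral {- real K - 1/2..real K + 1/2} h
      + (integral {-1/2..1/2} (\<lambda>y. h (y + real (Suc K))) + integral {-1/2..1/2} (\<lambda>y. h (y - real (Suc K))))"
    using shift[of "real (Suc K)"] shift[of "- real (Suc K)"] unfolding bounds
    unfolding add_uminus_conv_diff by (simp only: ac_simps)
  then show ?case
    by (subst sum.lessThan_Suc, subst Suc.IH) (subst if_not_P, simp, simp only:)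
qed simp

lemma abs_dirichlet_le: "\<bar>dirichlet J y\<bar> \<le> 1 + 2 * real J"
proof -
  have "\<bar>\<Sum>j=1..J. cos (2 * pi * real j * y)\<bar> \<le> (\<Sum>j=1..J. 1)"
    by (intro order_trans[OF sum_abs] sum_mono) auto
  then have "\<bar>\<Sum>j=1..J. cos (2 * pi * real j * y)\<bar> \<le> real J" by simp
  then show ?thesis unfolding dirichlet_def by linarith
qed

lemma integrable_mult_dirichlet:
  assumes "integrable lborel f"
  shows "integrable lborel (\<lambda>y. f y * dirichlet J y)"
proof (rule Bochner_Integration.integrable_bound)
  show "integrable lborel (\<lambda>y. (1 + 2 * real J) * norm (f y))"
    using assms by auto
  show "AE y in lborel. norm (f y * dirichlet J y) \<le> norm ((1 + 2 * real J) * norm (f y))"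
    using abs_dirichlet_le[of J]
    by (intro AE_I2) (simp add: abs_mult mult.commute mult_left_mono)
qed (use assms in measurable)

lemma integral_symmetric_intervals_tendsto:
  fixes h :: "real \<Rightarrow> real"
  assumes h: "integrable lborel h"
  shows "(\<lambda>K. integral {- real K - 1/2..real K + 1/2} h) \<longlonglongrightarrow> integral\<^sup>L lborel h"
proof -
  let ?I = "\<lambda>K::nat. {- real K - 1/2..real K + 1/2}"
  have "(\<lambda>K. \<integral>y. indicator (?I K) y * h y \<partial>lborel) \<longlonglongrightarrow> (\<integral>y. h y \<partial>lborel)"
  proof (rule integral_dominated_convergence[where w = "\<lambda>y. norm (h y)"])
    show "AE y in lborel. (\<lambda>K. indicator (?I K) y * h y) \<longlonglongrightarrow> h y"
    proof (rule AE_I2)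
      fix y :: real
      have "\<forall>\<^sub>F K in sequentially. indicator (?I K) y * h y = h y"
        using eventually_ge_at_top[of "nat \<lceil>\<bar>y\<bar>\<rceil>"]
      proof eventually_elim
        case (elim K)
        then have "\<bar>y\<bar> \<le> real K" by linarith
        then show ?case by (auto simp: indicator_def)
      qed
      then show "(\<lambda>K. indicator (?I K) y * h y) \<longlonglongrightarrow> h y"
        by (simp add: tendsto_eventually)
    qed
  qed (use h in \<open>auto simp: indicator_def\<close>)
  moreover have "(\<integral>y. indicator (?I K) y * h y \<partial>lborel) = integral (?I K) h" for K
  proof -
    have "set_integrable lborel (?I K) h"
      using h unfolding set_integrable_def by (intro integrable_mult_indicator) auto
    from set_borel_integral_eq_integral(2)[OF this] show ?thesis
      by (simp add: set_lebesgue_integral_def)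
  qed
  ultimately show ?thesis by simp
qed

text \<open>Unfolding the line into unit intervals reduces the claim to pointwise convergence of
  Dirichlet integrals on each of them, summed by Tannery's theorem.\<close>

theorem poisson_dirichlet:
  fixes f f' :: "real \<Rightarrow> real"
  assumes der: "\<And>y. (f has_real_derivative f' y) (at y)"
    and f': "\<And>y. \<bar>f' y\<bar> \<le> C * exp (- \<bar>y\<bar>)"
    and int: "integrable lborel f"
    and sm: "(\<lambda>k::int. f (real_of_int k)) summable_on UNIV"
  shows "(\<lambda>J. \<integral>y. f y * dirichlet J y \<partial>lborel) \<longlonglongrightarrow> (\<Sum>\<^sub>\<infinity>k::int. f (real_of_int k))"
proof -
  have contf: "continuous_on A f" for A
    by (meson DERIV_isCont continuous_at_imp_continuous_on der)
  obtain K where K: "\<And>y. y \<in> {-1/2..1/2} \<Longrightarrow> norm (sin_ratio y) \<le> K"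
    using compact_imp_bounded[OF compact_continuous_image[OF continuous_on_sin_ratio compact_Icc]]
    unfolding bounded_iff by blast
  have C0: "0 \<le> C" using f'[of 0] by simp
  have K0: "0 \<le> K" using K[of 0] by (simp)
  \<comment> \<open>The Dirichlet integral over the unit interval centred at \<open>c\<close>; the
    kernel has period 1, so only \<open>f\<close> is shifted.\<close>
  define B where "B = (\<lambda>J c. integral {-1/2..1/2} (\<lambda>y. f (y + c) * dirichlet J y))"
  have B: "(\<lambda>J. B J c) \<longlonglongrightarrow> f c" "\<bar>B J c - f c\<bar> \<le> C * exp 1 * exp (- \<bar>c\<bar>) * K" for J c
  proof -
    have 1: "((\<lambda>y. f (y + c)) has_real_derivative f' (y + c)) (at y)" for y
      using DERIV_shift der by blast
    have 2: "\<bar>f' (y + c)\<bar> \<le> C * exp 1 * exp (- \<bar>c\<bar>)" if "y \<in> {-1/2..1/2}" for y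
    proof -
      have "\<bar>f' (y + c)\<bar> \<le> C * exp (- \<bar>y + c\<bar>)" by (rule f')
      \<comment> \<open>Moving by at most 1/2 changes the absolute value by less than 1, whence the
        factor \<open>exp 1\<close>.\<close>
      also have "\<dots> \<le> C * exp (1 - \<bar>c\<bar>)"
        using that C0 by (intro mult_left_mono) auto
      also have "\<dots> = C * exp 1 * exp (- \<bar>c\<bar>)" by (simp add: exp_diff exp_minus field_simps)
      finally show ?thesis .
    qed
    show "(\<lambda>J. B J c) \<longlonglongrightarrow> f c" "\<bar>B J c - f c\<bar> \<le> C * exp 1 * exp (- \<bar>c\<bar>) * K"
      using dirichlet_kernel_integral[OF 1 2 K[unfolded real_norm_def]] by (simp_all add: B_def)
  qed
  define a where "a = (\<lambda>k J. if k = 0 then B J 0 else B J (real k) + B J (- real k))"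
  define b where "b = (\<lambda>k::nat. if k = 0 then f 0 else f (real k) + f (- real k))"
  \<comment> \<open>The Tannery majorant: the limit term plus the uniform distance to it, doubled
    because \<open>k\<close> and \<open>- k\<close> are grouped.\<close>
  define M where "M = (\<lambda>k::nat. norm (b k) + 2 * (C * exp 1 * exp (- real k) * K))"
  have asums: "(\<lambda>k. a k J) sums (\<integral>y. f y * dirichlet J y \<partial>lborel)" for J
  proof -
    have part: "(\<Sum>k<Suc L. a k J) = integral {- real L - 1/2..real L + 1/2} (\<lambda>y. f y * dirichlet J y)" for L
    proof -
      have shift: "dirichlet J (y + real k) = dirichlet J y" "dirichlet J (y - real k) = dirichlet J y" for k y
        using dirichlet_add_int[of J y "int k"] dirichlet_add_int[of J y "- int k"] by simp_all
      have a: "a k J = (if k = 0 then integral {-1/2..1/2} (\<lambda>y. f y * dirichlet J y)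
         else integral {-1/2..1/2} (\<lambda>y. f (y + real k) * dirichlet J (y + real k))
            + integral {-1/2..1/2} (\<lambda>y. f (y - real k) * dirichlet J (y - real k)))" for k
        by (simp add: a_def B_def shift)
      show ?thesis
        unfolding a by (intro integral_unit_intervals continuous_on_mult contf continuous_on_dirichlet)
    qed
    show ?thesis unfolding sums_def
      by (rule LIMSEQ_imp_Suc, unfold part)
        (intro integral_symmetric_intervals_tendsto integrable_mult_dirichlet int)
  qed
  have bsums: "b sums (\<Sum>\<^sub>\<infinity>k::int. f (real_of_int k))"
    using has_sum_int_imp_sums[OF has_sum_infsum[OF sm]] by (simp add: b_def cong: if_cong)
  have sumM: "summable M"
  proof -
    have "summable (\<lambda>k. \<bar>f (real_of_int (int k))\<bar>)" "summable (\<lambda>k. \<bar>f (real_of_int (- int k))\<bar>)"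
    proof -
      have "(\<lambda>k::int. norm (f (real_of_int k))) summable_on UNIV"
        by (rule iffD1[OF summable_on_iff_abs_summable_on_real sm])
      then have "(\<lambda>k::int. norm (f (real_of_int k))) summable_on range int"
           "(\<lambda>k::int. norm (f (real_of_int k))) summable_on range (\<lambda>n. - int n)"
        by (auto intro: summable_on_subset_banach)
      then show "summable (\<lambda>k. \<bar>f (real_of_int (int k))\<bar>)" "summable (\<lambda>k. \<bar>f (real_of_int (- int k))\<bar>)"
        by (auto simp: summable_on_reindex inj_on_def o_def dest!: summable_on_imp_summable)
    qed
    then have "summable (\<lambda>k. \<bar>f (real_of_int (int k))\<bar> + \<bar>f (real_of_int (- int k))\<bar>)"
      by (rule summable_add)
    then have "summable (\<lambda>k. norm (b k))"
      by (rule summable_comparison_test'[where N = 1]) (auto simp: b_def)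
    then show ?thesis unfolding M_def
      by (intro summable_add summable_mult summable_mult2 summable_exp_minus)
  qed
  have aM: "norm (a k J) \<le> M k" for k J
  proof -
    have "norm (a k J - b k) \<le> 2 * (C * exp 1 * exp (- real k) * K)"
    proof (cases "k = 0")
      case True
      have "\<bar>B J 0 - f 0\<bar> \<le> C * exp 1 * 1 * K" using B(2)[of J 0] by simp
      also have "\<dots> \<le> 2 * (C * exp 1 * 1 * K)" using C0 K0 by simp
      finally show ?thesis using True by (simp add: a_def b_def)
    next
      case False
      then show ?thesis using B(2)[of J "real k"] B(2)[of J "- real k"] by (simp add: a_def b_def)
    qed
    then show ?thesis unfolding M_def real_norm_def by linarith
  qed
  have "(\<lambda>J. suminf (\<lambda>k. a k J)) \<longlonglongrightarrow> suminf b"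
  proof (intro conjunct2[OF conjunct2[OF tannerys_theorem[where M = M]]] sumM)
    show "(\<lambda>J. a k J) \<longlonglongrightarrow> b k" for k
      unfolding a_def b_def by (auto intro!: tendsto_intros B)
    show "\<forall>\<^sub>F (k, J) in at_top \<times>\<^sub>F sequentially. norm (a k J) \<le> M k"
      using aM by (intro always_eventually) auto
  qed simp
  then show ?thesis
    using sums_unique[OF asums] sums_unique[OF bsums] by simp
qed

section \<open>Gaussians and their Fourier transform\<close>

lemma gaussian_decay:
  assumes s: "0 < s"
  shows "exp (- pi * s * v\<^sup>2) \<le> exp (1 / (pi * s)) * exp (- 2 * \<bar>v\<bar>)"
proof -
  \<comment> \<open>Expanding this square bounds the quadratic exponent below by
    \<open>2 * \<bar>v\<bar>\<close> up to a constant.\<close>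
  have "0 \<le> (pi * s * \<bar>v\<bar> - 1)\<^sup>2 / (pi * s)" using s by simp
  also have "\<dots> = pi * s * v\<^sup>2 - 2 * \<bar>v\<bar> + 1 / (pi * s)"
    using s by (simp add: power2_diff divide_simps power2_eq_square algebra_simps)
  finally show ?thesis by (simp flip: exp_add)
qed

text \<open>The second bound is meant for the derivative of the Gaussian: of the decay rate 2 in
  \<open>gaussian_decay\<close>, one unit absorbs the linear factor and the other remains.\<close>

lemma gaussian_decay_shift:
  assumes s: "0 < s"
  shows "exp (- pi * s * (x + y)\<^sup>2) \<le> exp (1 / (pi * s) + \<bar>x\<bar>) * exp (- \<bar>y\<bar>)"
    and "\<bar>x + y\<bar> * exp (- pi * s * (x + y)\<^sup>2) \<le> exp (1 / (pi * s) + \<bar>x\<bar>) * exp (- \<bar>y\<bar>)"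
proof -
  have *: "exp (- \<bar>x + y\<bar>) \<le> exp \<bar>x\<bar> * exp (- \<bar>y\<bar>)" by (simp flip: exp_add)
  have "\<bar>x + y\<bar> * exp (- pi * s * (x + y)\<^sup>2) \<le> exp \<bar>x + y\<bar> * (exp (1 / (pi * s)) * exp (- 2 * \<bar>x + y\<bar>))"
  proof (rule mult_mono)
    have "1 + \<bar>x + y\<bar> \<le> exp \<bar>x + y\<bar>" by (rule exp_ge_add_one_self)
    then show "\<bar>x + y\<bar> \<le> exp \<bar>x + y\<bar>" by linarith
  qed (use gaussian_decay[OF s] in auto)
  also have "\<dots> = exp (1 / (pi * s)) * exp (- \<bar>x + y\<bar>)" by (simp flip: exp_add)
  also have "\<dots> \<le> exp (1 / (pi * s)) * (exp \<bar>x\<bar> * exp (- \<bar>y\<bar>))" by (intro mult_left_mono *) auto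
  finally show "\<bar>x + y\<bar> * exp (- pi * s * (x + y)\<^sup>2) \<le> exp (1 / (pi * s) + \<bar>x\<bar>) * exp (- \<bar>y\<bar>)"
    by (simp add: exp_add)
  have "exp (- pi * s * (x + y)\<^sup>2) \<le> exp (1 / (pi * s)) * exp (- 2 * \<bar>x + y\<bar>)" by (rule gaussian_decay[OF s])
  also have "\<dots> \<le> exp (1 / (pi * s)) * exp (- \<bar>x + y\<bar>)" by simp
  also have "\<dots> \<le> exp (1 / (pi * s)) * (exp \<bar>x\<bar> * exp (- \<bar>y\<bar>))" by (intro mult_left_mono *) auto
  finally show "exp (- pi * s * (x + y)\<^sup>2) \<le> exp (1 / (pi * s) + \<bar>x\<bar>) * exp (- \<bar>y\<bar>)"
    by (simp add: exp_add)
qed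

lemma summable_on_gaussian:
  assumes "0 < s"
  shows "(\<lambda>k::int. exp (- pi * s * (x + real_of_int k)\<^sup>2)) summable_on UNIV"
proof (rule summable_on_int)
  have "summable (\<lambda>n. exp (1 / (pi * s) + \<bar>x\<bar>) * exp (- real n))"
    by (intro summable_mult summable_exp_minus)
  note * = summable_comparison_test'[OF this, where N = 0]
  show "summable (\<lambda>n. norm (exp (- pi * s * (x + real_of_int (int n))\<^sup>2)))"
    using gaussian_decay_shift(1)[OF assms, of x "real _"] by (intro *) simp
  show "summable (\<lambda>n. norm (exp (- pi * s * (x + real_of_int (- int n))\<^sup>2)))"
    using gaussian_decay_shift(1)[OF assms, of x "- real _"] by (intro *) simp
qed

lemma integrable_gaussian:
  assumes s: "0 < s"
  shows "integrable lborel (\<lambda>y. exp (- pi * s * (x + y)\<^sup>2))"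
proof -
  define \<sigma> where "\<sigma> = 1 / sqrt (2 * pi * s)"
  have \<sigma>: "0 < \<sigma>" using s by (simp add: \<sigma>_def)
  have \<sigma>2: "\<sigma>\<^sup>2 = 1 / (2 * pi * s)" using s by (simp add: \<sigma>_def power_divide)
  have "exp (- pi * s * (x + y)\<^sup>2) = sqrt (2 * pi * \<sigma>\<^sup>2) * normal_density (- x) \<sigma> y" for y
    using s by (simp add: normal_density_def \<sigma>2 add.commute)
  then show ?thesis using integrable_normal_density[OF \<sigma>, of "- x"] by simp
qed

text \<open>This is the characteristic function of the standard normal law after the substitution v
  = c (x + y) with c^2 = 2 pi s. The phase \<open>iexp (2 * pi * j * x)\<close> is moved to the
  other side before real parts are taken, so that only its cosine survives.\<close>

lemma gaussian_fourier:
  assumes s: "0 < s"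
  shows "(\<integral>y. exp (- pi * s * (x + y)\<^sup>2) * cos (2 * pi * j * y) \<partial>lborel) =
     exp (- pi * j\<^sup>2 / s) * cos (2 * pi * j * x) / sqrt s"
proof -
  define c where "c = sqrt (2 * pi * s)"
  have c: "0 < c" and c2: "c\<^sup>2 = 2 * pi * s" using s by (simp_all add: c_def)
  define t where "t = 2 * pi * j / c"
  define f where "f = (\<lambda>y. exp (- pi * s * (x + y)\<^sup>2))"
  have "complex_of_real (exp (- (t\<^sup>2) / 2)) = (CLINT v|std_normal_distribution. iexp (t * v))"
    using fun_cong[OF char_std_normal_distribution, of t] by (simp add: char_def)
  also have "\<dots> = (CLINT v|lborel. std_normal_density v *\<^sub>R iexp (t * v))"
    by (rule integral_density) auto
  also have "\<dots> = c *\<^sub>R (CLINT y|lborel. std_normal_density (c * x + c * y) *\<^sub>R iexp (t * (c * x + c * y)))"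
    using c by (subst lborel_integral_real_affine[where c = c and t = "c * x"]) auto
  also have "(\<lambda>y. std_normal_density (c * x + c * y) *\<^sub>R iexp (t * (c * x + c * y))) =
      (\<lambda>y. iexp (2 * pi * j * x) / sqrt (2 * pi) * (f y *\<^sub>R iexp (2 * pi * j * y)))"
  proof
    fix y
    have "(c * x + c * y)\<^sup>2 / 2 = pi * s * (x + y)\<^sup>2"
      using c2 by (simp add: power_mult_distrib flip: distrib_left)
    then have "std_normal_density (c * x + c * y) = f y / sqrt (2 * pi)"
      by (simp add: std_normal_density_def f_def)
    moreover have "t * (c * x + c * y) = 2 * pi * j * x + 2 * pi * j * y"
      using c by (simp add: t_def field_simps)
    then have "iexp (t * (c * x + c * y)) = iexp (2 * pi * j * x) * iexp (2 * pi * j * y)"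
      by (simp only: of_real_add distrib_left exp_add)
    ultimately show "std_normal_density (c * x + c * y) *\<^sub>R iexp (t * (c * x + c * y)) =
       iexp (2 * pi * j * x) / sqrt (2 * pi) * (f y *\<^sub>R iexp (2 * pi * j * y))"
      by (simp add: scaleR_conv_of_real)
  qed
  also have "(CLINT y|lborel. iexp (2 * pi * j * x) / sqrt (2 * pi) * (f y *\<^sub>R iexp (2 * pi * j * y)))
    = iexp (2 * pi * j * x) / sqrt (2 * pi) * (CLINT y|lborel. f y *\<^sub>R iexp (2 * pi * j * y))"
    by (rule integral_mult_right_zero)
  finally have 1: "complex_of_real (exp (- (t\<^sup>2) / 2)) =
     c *\<^sub>R (iexp (2 * pi * j * x) / sqrt (2 * pi) * (CLINT y|lborel. f y *\<^sub>R iexp (2 * pi * j * y)))" .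
  have t2: "- (t\<^sup>2) / 2 = - pi * j\<^sup>2 / s"
    using s by (simp add: t_def power_divide c2 power_mult_distrib) (simp add: field_simps power2_eq_square)
  have cs: "c / sqrt (2 * pi) = sqrt s" using s by (simp add: c_def real_sqrt_mult)
  have i1: "iexp (- (2 * pi * j * x)) * iexp (2 * pi * j * x) = 1"
    by (simp flip: exp_add)
  have "sqrt s * (CLINT y|lborel. f y *\<^sub>R iexp (2 * pi * j * y)) =
      iexp (- (2 * pi * j * x)) * complex_of_real (exp (- (t\<^sup>2) / 2))"
  proof -
    have "a' * (c *\<^sub>R (a / complex_of_real r * X)) = a' * a * (complex_of_real (c / r) * X)"
      for a a' X :: complex and r
      by (simp add: scaleR_conv_of_real)
    note this[of "iexp (- (2 * pi * j * x))" "iexp (2 * pi * j * x)" "sqrt (2 * pi)"]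
    then show ?thesis unfolding 1 cs i1 mult_1_left by (rule sym)
  qed
  then have "Re (sqrt s * (CLINT y|lborel. f y *\<^sub>R iexp (2 * pi * j * y))) =
      Re (iexp (- (2 * pi * j * x)) * complex_of_real (exp (- (t\<^sup>2) / 2)))"
    by (rule arg_cong)
  then have "sqrt s * Re (CLINT y|lborel. f y *\<^sub>R iexp (2 * pi * j * y)) =
      Re (iexp (- (2 * pi * j * x)) * complex_of_real (exp (- (t\<^sup>2) / 2)))"
    by (simp only: times_complex.sel Re_complex_of_real Im_complex_of_real mult_zero_left diff_zero)
  also have "\<dots> = cos (2 * pi * j * x) * exp (- (t\<^sup>2) / 2)"
    by (simp add: Re_exp)
  finally have 2: "sqrt s * Re (CLINT y|lborel. f y *\<^sub>R iexp (2 * pi * j * y)) = cos (2 * pi * j * x) * exp (- pi * j\<^sup>2 / s)"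
    unfolding t2 .
  have "integrable lborel (\<lambda>y. f y *\<^sub>R iexp (2 * pi * j * y))"
    by (rule Bochner_Integration.integrable_bound[OF integrable_gaussian[OF s, of x]]) (auto simp: f_def)
  from integral_Re[OF this]
  have 3: "Re (CLINT y|lborel. f y *\<^sub>R iexp (2 * pi * j * y)) = (\<integral>y. f y * cos (2 * pi * j * y) \<partial>lborel)"
    by (simp add: Re_exp)
  have "(\<integral>y. f y * cos (2 * pi * j * y) \<partial>lborel) = exp (- pi * j\<^sup>2 / s) * cos (2 * pi * j * x) / sqrt s"
  proof -
    have "b = e * c / a" if "a * b = c * e" "a \<noteq> 0" for a b c e :: real
      using that by (metis mult.commute nonzero_mult_div_cancel_left)
    from this[OF 2] s show ?thesis unfolding 3 by simp
  qed
  then show ?thesis by (simp only: f_def)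
qed

definition gauss_sum :: "real \<Rightarrow> real \<Rightarrow> real" where
  "gauss_sum s x = (\<Sum>\<^sub>\<infinity>k::int. exp (- pi * s * (x + real_of_int k)\<^sup>2))"

text \<open>Jacobi's transformation from s to 1 / s, obtained by integrating the Gaussian against
  the Dirichlet kernels. It is solved for the terms beyond the leading 1, which are the error as s
  tends to 0.\<close>

theorem gauss_sum_fourier:
  assumes s: "0 < s"
  shows "(\<lambda>j. exp (- pi * (real (Suc j))\<^sup>2 / s) * cos (2 * pi * real (Suc j) * x)) sums
     ((sqrt s * gauss_sum s x - 1) / 2)"
proof -
  define f where "f = (\<lambda>y. exp (- pi * s * (x + y)\<^sup>2))"
  define c where "c = (\<lambda>j. exp (- pi * (real j)\<^sup>2 / s) * cos (2 * pi * real j * x))"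
  have int: "integrable lborel f" unfolding f_def by (rule integrable_gaussian[OF s])
  have lim: "(\<lambda>J. \<integral>y. f y * dirichlet J y \<partial>lborel) \<longlonglongrightarrow> (\<Sum>\<^sub>\<infinity>k::int. f (real_of_int k))"
  proof (rule poisson_dirichlet[where f' = "\<lambda>y. - 2 * pi * s * (x + y) * f y"])
    show "\<bar>- 2 * pi * s * (x + y) * f y\<bar> \<le> 2 * pi * s * exp (1 / (pi * s) + \<bar>x\<bar>) * exp (- \<bar>y\<bar>)" for y
      using mult_left_mono[OF gaussian_decay_shift(2)[OF s, of x y], of "2 * pi * s"] s
      by (simp add: abs_mult f_def mult.assoc)
    show "(f has_real_derivative - 2 * pi * s * (x + y) * f y) (at y)" for y
      unfolding f_def by (auto intro!: derivative_eq_intros)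
    show "(\<lambda>k::int. f (real_of_int k)) summable_on UNIV"
      unfolding f_def by (rule summable_on_gaussian[OF s])
  qed (rule int)
  have fc: "(\<integral>y. f y * cos (2 * pi * real j * y) \<partial>lborel) = c j / sqrt s" for j
    unfolding f_def gaussian_fourier[OF s] c_def by simp
  have f0: "(\<integral>y. f y \<partial>lborel) = 1 / sqrt s"
    using fc[of 0] by (simp add: c_def)
  have ifc: "integrable lborel (\<lambda>y. f y * cos (2 * pi * real j * y))" for j
    by (rule Bochner_Integration.integrable_bound[OF int]) (auto simp: f_def abs_mult intro!: mult_left_le)
  have val: "(\<integral>y. f y * dirichlet J y \<partial>lborel) = (1 + 2 * (\<Sum>j=1..J. c j)) / sqrt s" for J
  proof -
    have "(\<integral>y. f y * dirichlet J y \<partial>lborel) = (\<integral>y. f y + 2 * (\<Sum>j=1..J. f y * cos (2 * pi * real j * y)) \<partial>lborel)"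
      by (simp add: dirichlet_def algebra_simps sum_distrib_left)
    also have "\<dots> = 1 / sqrt s + 2 * (\<Sum>j=1..J. c j / sqrt s)"
      using int ifc by (simp add: fc f0)
    finally show ?thesis by (simp add: add_divide_distrib sum_distrib_left sum_divide_distrib)
  qed
  have "(\<lambda>J. (sqrt s * ((1 + 2 * (\<Sum>j=1..J. c j)) / sqrt s) - 1) / 2) \<longlonglongrightarrow> (sqrt s * gauss_sum s x - 1) / 2"
    using lim unfolding val unfolding gauss_sum_def f_def by (intro tendsto_intros) auto
  moreover have "(sqrt s * ((1 + 2 * (\<Sum>j=1..J. c j)) / sqrt s) - 1) / 2 = (\<Sum>j<J. c (Suc j))" for J
    using s by (simp add: sum.atLeast1_atMost_eq)
  ultimately show ?thesis by (simp add: sums_def c_def)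
qed

section \<open>Alternating Gaussian sums\<close>

definition gauss_sum_alt :: "real \<Rightarrow> real \<Rightarrow> real" where
  "gauss_sum_alt s x = (\<Sum>\<^sub>\<infinity>k::int. (- 1) powi k * exp (- pi * s * (x + real_of_int k)\<^sup>2))"

lemma has_sum_gauss_sum:
  assumes "0 < s"
  shows "((\<lambda>k::int. exp (- pi * s * (x + real_of_int k)\<^sup>2)) has_sum gauss_sum s x) UNIV"
  unfolding gauss_sum_def by (intro has_sum_infsum summable_on_gaussian assms)

text \<open>The sign is twice the indicator of the even integers minus 1, and the even translates
  form a Gaussian sum with parameters 4 s and x / 2. No second Poisson summation is needed.\<close>

lemma has_sum_alternating_gaussian:
  assumes s: "0 < s"
  shows "((\<lambda>k::int. (- 1) powi k * exp (- pi * s * (x + real_of_int k)\<^sup>2)) has_sum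
     (2 * gauss_sum (4 * s) (x / 2) - gauss_sum s x)) UNIV"
proof -
  define h where "h = (\<lambda>k::int. exp (- pi * s * (x + real_of_int k)\<^sup>2))"
  have "(\<lambda>k::int. exp (- pi * (4 * s) * (x / 2 + real_of_int k)\<^sup>2)) = (\<lambda>k. h (2 * k))"
  proof
    fix k :: int
    have "4 * (x / 2 + real_of_int k)\<^sup>2 = (x + real_of_int (2 * k))\<^sup>2"
      by (simp add: power2_eq_square algebra_simps)
    then have "s * (4 * (x / 2 + real_of_int k)\<^sup>2) = s * (x + real_of_int (2 * k))\<^sup>2"
      by (rule arg_cong)
    then show "exp (- pi * (4 * s) * (x / 2 + real_of_int k)\<^sup>2) = h (2 * k)"
      by (simp add: h_def mult_ac)
  qed
  then have "((\<lambda>k. h (2 * k)) has_sum gauss_sum (4 * s) (x / 2)) UNIV"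
    using has_sum_gauss_sum[of "4 * s" "x / 2"] s by simp
  then have "(h has_sum gauss_sum (4 * s) (x / 2)) (range (\<lambda>k. 2 * k))"
    by (subst has_sum_reindex) (auto simp: o_def inj_on_def)
  also have "?this \<longleftrightarrow> ((\<lambda>k. if even k then h k else 0) has_sum gauss_sum (4 * s) (x / 2)) UNIV"
    by (rule has_sum_cong_neutral) (auto elim!: evenE)
  finally have "((\<lambda>k. 2 * (if even k then h k else 0) + - h k) has_sum
      (2 * gauss_sum (4 * s) (x / 2) + - gauss_sum s x)) UNIV"
    using has_sum_gauss_sum[OF s, of x] unfolding h_def
    by (intro has_sum_add has_sum_uminusI has_sum_cmult_right)
  also have "(\<lambda>k. 2 * (if even k then h k else 0) + - h k) = (\<lambda>k. (- 1) powi k * h k)"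
    by (auto simp: power_int_minus_left)
  finally show ?thesis by (simp add: h_def)
qed

lemma gauss_sum_alt_eq:
  assumes s: "0 < s"
  shows "gauss_sum_alt s x = 2 * gauss_sum (4 * s) (x / 2) - gauss_sum s x"
  unfolding gauss_sum_alt_def by (rule infsumI[OF has_sum_alternating_gaussian[OF s]])

lemma has_sum_gauss_sum_alt:
  assumes s: "0 < s"
  shows "((\<lambda>k::int. (- 1) powi k * exp (- pi * s * (x + real_of_int k)\<^sup>2)) has_sum gauss_sum_alt s x) UNIV"
  unfolding gauss_sum_alt_eq[OF s] by (rule has_sum_alternating_gaussian[OF s])

text \<open>In the difference of the two transformed series the constant terms and all even
  frequencies cancel. What is left starts with exp (- pi / (4 s)) cos (pi x), so the alternating sum
  is exponentially small as s tends to 0.\<close>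

theorem gauss_sum_alt_fourier:
  assumes s: "0 < s"
  shows "(\<lambda>j. exp (- pi * (real j + 1/2)\<^sup>2 / s) * cos (pi * (2 * real j + 1) * x)) sums
     (sqrt s * gauss_sum_alt s x / 2)"
proof -
  define a where "a = (\<lambda>j. exp (- pi * (real j)\<^sup>2 / (4 * s)) * cos (pi * real j * x))"
  define A where "A = (2 * sqrt s * gauss_sum (4 * s) (x / 2) - 1) / 2"
  define B where "B = (sqrt s * gauss_sum s x - 1) / 2"
  have A: "(\<lambda>n. a (Suc n)) sums A"
    using gauss_sum_fourier[of "4 * s" "x / 2"] s by (simp add: a_def A_def real_sqrt_mult mult.assoc)
  have B: "(\<lambda>j. a (2 * Suc j)) sums B"
  proof -
    have "a (2 * Suc j) = exp (- pi * (real (Suc j))\<^sup>2 / s) * cos (2 * pi * real (Suc j) * x)" for j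
    proof -
      have "- pi * (real (2 * Suc j))\<^sup>2 / (4 * s) = - pi * (real (Suc j))\<^sup>2 / s"
        "pi * real (2 * Suc j) * x = 2 * pi * real (Suc j) * x"
        using s by (simp_all add: power2_eq_square field_simps)
      then show ?thesis unfolding a_def by (simp only:)
    qed
    then show ?thesis using gauss_sum_fourier[OF s, of x] by (simp add: B_def)
  qed
  have "(\<Sum>j<J. a (2 * j + 1)) = (\<Sum>n<2 * J. a (Suc n)) - (\<Sum>j<J. a (2 * Suc j))" for J
    by (induction J) auto
  moreover have "(\<lambda>J. \<Sum>n<2 * J. a (Suc n)) \<longlonglongrightarrow> A"
    using A unfolding sums_def by (rule filterlim_compose) (simp add: mult_nat_left_at_top)
  ultimately have "(\<lambda>j. a (2 * j + 1)) sums (A - B)"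
    using B unfolding sums_def by (auto intro: tendsto_diff)
  moreover have "A - B = sqrt s * gauss_sum_alt s x / 2"
    by (simp add: A_def B_def gauss_sum_alt_eq[OF s] algebra_simps diff_divide_distrib)
  moreover have "a (2 * j + 1) = exp (- pi * (real j + 1/2)\<^sup>2 / s) * cos (pi * (2 * real j + 1) * x)" for j
  proof -
    have "- pi * (real (2 * j + 1))\<^sup>2 / (4 * s) = - pi * (real j + 1/2)\<^sup>2 / s"
      using s by (simp add: power2_eq_square field_simps)
    moreover have "pi * real (2 * j + 1) * x = pi * (2 * real j + 1) * x" by simp
    ultimately show ?thesis unfolding a_def by (simp only:)
  qed
  ultimately show ?thesis by simp
qed

subsection \<open>The pentagonal number theorem\<close>

lemma qpoch_Suc: "qpoch c q (Suc n) = qpoch c q n * (1 - c * q ^ n)"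
  by (simp add: qpoch_def)

lemma qpoch_0 [simp]: "qpoch c q 0 = 1"
  by (simp add: qpoch_def)

context
  fixes q :: real
  assumes q: "0 < q" "q < 1"
begin

lemma qpoch_factor: "0 < 1 - q * q ^ n" "1 - q * q ^ n \<le> 1"
proof -
  have "q ^ Suc n < 1" using q by (intro power_Suc_less_one) auto
  then show "0 < 1 - q * q ^ n" by simp
qed (use q in auto)

lemma qpoch_pos: "0 < qpoch q q n"
  by (induction n) (use qpoch_factor(1) in \<open>auto simp: qpoch_Suc\<close>)

lemma qpoch_antimono: "m \<le> n \<Longrightarrow> qpoch q q n \<le> qpoch q q m"
proof (induction n rule: dec_induct)
  case (step n)
  have "qpoch q q (Suc n) \<le> qpoch q q n * 1"
    unfolding qpoch_Suc using qpoch_pos[of n] qpoch_factor(2)[of n] by (intro mult_left_mono) auto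
  then show ?case using step by simp
qed simp

lemma qpoch_tendsto: "(\<lambda>n. qpoch q q n) \<longlonglongrightarrow> qpoch_inf q q"
proof -
  have "abs_convergent_prod (\<lambda>k. 1 - q * q ^ k)"
    using q by (auto simp: abs_convergent_prod_conv_summable intro!: summable_mult summable_geometric)
  then have "convergent_prod (\<lambda>k. 1 - q * q ^ k)"
    by (rule abs_convergent_prod_imp_convergent_prod)
  from convergent_prod_LIMSEQ[OF this] have "(\<lambda>n. qpoch q q (Suc n)) \<longlonglongrightarrow> qpoch_inf q q"
    by (simp add: qpoch_def qpoch_inf_def lessThan_Suc_atMost)
  then show ?thesis by (rule LIMSEQ_imp_Suc)
qed

lemma qpoch_inf_le: "qpoch_inf q q \<le> qpoch q q n"
  by (rule LIMSEQ_le_const2[OF qpoch_tendsto]) (use qpoch_antimono in blast)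

text \<open>A product of factors 1 - x is at least 1 minus the sum of the x, here a geometric tail.
  The induction carries the finite geometric sum and the limit over \<open>k\<close> is taken last.
  This is the quantitative source of every estimate of (q;q)_n against (q;q)_inf below.\<close>

lemma qpoch_inf_ge: "qpoch q q n * (1 - q ^ Suc n / (1 - q)) \<le> qpoch_inf q q"
proof (rule LIMSEQ_le_const[OF LIMSEQ_ignore_initial_segment[OF qpoch_tendsto, of n]], intro exI allI impI)
  fix k
  have "qpoch q q n * (1 - (q ^ Suc n - q ^ Suc (n + k)) / (1 - q)) \<le> qpoch q q (n + k)"
  proof (induction k)
    case (Suc k)
    have "qpoch q q n * (1 - (q ^ Suc n - q ^ Suc (n + Suc k)) / (1 - q)) =
       qpoch q q n * (1 - (q ^ Suc n - q ^ Suc (n + k)) / (1 - q)) - qpoch q q n * q ^ Suc (n + k)"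
      using q by (simp add: field_simps)
    also have "\<dots> \<le> qpoch q q (n + k) - qpoch q q (n + k) * q ^ Suc (n + k)"
      using q qpoch_antimono[of n "n + k"] by (intro diff_mono Suc mult_right_mono) auto
    also have "\<dots> = qpoch q q (n + Suc k)" by (simp add: qpoch_Suc algebra_simps)
    finally show ?case .
  qed simp
  moreover have "qpoch q q n * (1 - q ^ Suc n / (1 - q)) \<le> qpoch q q n * (1 - (q ^ Suc n - q ^ Suc (n + k)) / (1 - q))"
    using q qpoch_pos[of n] by (intro mult_left_mono diff_left_mono divide_right_mono) auto
  ultimately show "qpoch q q n * (1 - q ^ Suc n / (1 - q)) \<le> qpoch q q (k + n)"
    by (simp add: add.commute)
qed

lemma qpoch_inf_pos: "0 < qpoch_inf q q"
proof -
  have "(\<lambda>n. q ^ Suc n / (1 - q)) \<longlonglongrightarrow> 0 / (1 - q)"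
    using q by (intro tendsto_intros LIMSEQ_Suc LIMSEQ_power_zero) auto
  then have "\<forall>\<^sub>F n in sequentially. q ^ Suc n / (1 - q) < 1"
    by (intro order_tendstoD) auto
  then obtain n where "q ^ Suc n / (1 - q) < 1"
    by (auto simp: eventually_sequentially)
  then have "0 < qpoch q q n * (1 - q ^ Suc n / (1 - q))"
    using qpoch_pos[of n] by simp
  then show ?thesis using qpoch_inf_ge[of n] by linarith
qed

end

text \<open>Shanks' finite form of Euler's pentagonal number theorem. The base is written as \<open>p\<^sup>2\<close>
  so that the exponents \<open>s * (s + 1) / 2\<close> need no division.\<close>

lemma shanks:
  fixes p :: real
  assumes p: "0 < p" "p < 1"
  shows "(\<Sum>s\<le>n. (- 1) ^ s * (qpoch (p\<^sup>2) (p\<^sup>2) n / qpoch (p\<^sup>2) (p\<^sup>2) s) * p ^ (2 * s * n + s * (s + 1)))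
     = (\<Sum>s<Suc n. if s = 0 then 1 else (- 1) ^ s * (p ^ (3 * s\<^sup>2 - s) + p ^ (3 * s\<^sup>2 + s)))"
proof (induction n)
  case (Suc m)
  have q: "0 < p\<^sup>2" "p\<^sup>2 < 1" using p by (auto simp: power_less_one_iff)
  define Q where "Q = qpoch (p\<^sup>2) (p\<^sup>2)"
  have Q: "Q n \<noteq> 0" for n using qpoch_pos[OF q, of n] by (simp add: Q_def)
  have QS: "Q (Suc n) = Q n * (1 - p ^ (2 * Suc n))" for n
    by (simp add: Q_def qpoch_Suc power_mult power2_eq_square)
  \<comment> \<open>A telescoping certificate: passing from \<open>m\<close> to \<open>Suc m\<close>
    changes the summand at \<open>s\<close> by \<open>U (Suc s) - U s\<close>. As
    \<open>U 0 = 0\<close>, the sum collapses to \<open>U (Suc m)\<close>, one of the two new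
    pentagonal terms; the other is the summand at \<open>s = Suc m\<close>, which is absent for
    \<open>m\<close>.\<close>
  define U where "U = (\<lambda>s. if s = 0 then 0 else (- 1) ^ s * (Q m / Q (s - 1)) * p ^ (2 * s * Suc m + s * (s - 1)))"
  have step: "(- 1) ^ s * (Q (Suc m) / Q s) * p ^ (2 * s * Suc m + s * (s + 1))
     - (- 1) ^ s * (Q m / Q s) * p ^ (2 * s * m + s * (s + 1)) = U (Suc s) - U s" for s
  proof (cases s)
    case 0
    then show ?thesis by (simp add: U_def QS Q field_simps mult_2_right)
  next
    case (Suc r)
    \<comment> \<open>All four exponents are \<open>E\<close> plus multiples of
      \<open>2 * Suc r\<close> and \<open>2 * Suc m\<close>. With the powers named, the step is a
      rational identity whose only nontrivial denominator besides \<open>Q r\<close> is 1 - Y,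
      called \<open>W\<close> below.\<close>
    define E where "E = 2 * Suc r * Suc m + Suc r * r"
    define X Y Z where "X = p ^ E" and "Y = p ^ (2 * Suc r)" and "Z = p ^ (2 * Suc m)"
    have "2 * Suc r * Suc m + Suc r * (Suc r + 1) = E + 2 * Suc r"
      "2 * Suc r * m + Suc r * (Suc r + 1) = E"
      "2 * Suc (Suc r) * Suc m + Suc (Suc r) * Suc r = E + 2 * Suc r + 2 * Suc m"
      by (simp_all add: E_def algebra_simps)
    then have e: "p ^ (2 * Suc r * Suc m + Suc r * (Suc r + 1)) = X * Y"
      "p ^ (2 * Suc r * m + Suc r * (Suc r + 1)) = X"
      "p ^ (2 * Suc (Suc r) * Suc m + Suc (Suc r) * Suc r) = X * Y * Z"
      "p ^ (2 * Suc r * Suc m + Suc r * r) = X"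
      by (simp_all only: X_def Y_def Z_def power_add E_def)
    define W where "W = 1 - Y"
    have QW: "Q (Suc m) = Q m * (1 - Z)" "Q (Suc r) = Q r * W" and Y: "Y = 1 - W"
      by (simp_all only: QS Y_def Z_def W_def)
    have W: "W \<noteq> 0" using Q[of "Suc r"] QW by auto
    have US: "U (Suc s) = (- 1) ^ r * (Q m / (Q r * W)) * (X * Y * Z)"
      "U s = - ((- 1) ^ r) * (Q m / Q r) * X"
      using e by (simp_all only: Suc U_def diff_Suc_1 nat.distinct if_False QW power_Suc)
    show ?thesis
      unfolding US unfolding Suc e QW power_Suc Y using W Q[of r]
      by (simp add: field_simps)
  qed
  have "(\<Sum>s\<le>Suc m. (- 1) ^ s * (Q (Suc m) / Q s) * p ^ (2 * s * Suc m + s * (s + 1)))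
     - (\<Sum>s\<le>m. (- 1) ^ s * (Q m / Q s) * p ^ (2 * s * m + s * (s + 1)))
     = (\<Sum>s<Suc m. U (Suc s) - U s) + (- 1) ^ Suc m * (Q (Suc m) / Q (Suc m)) * p ^ (2 * Suc m * Suc m + Suc m * (Suc m + 1))"
    unfolding step[symmetric] by (simp only: sum.atMost_Suc sum_subtractf lessThan_Suc_atMost)
  also have "(\<Sum>s<Suc m. U (Suc s) - U s) = U (Suc m)"
    by (simp only: sum_lessThan_telescope) (simp add: U_def)
  also have "U (Suc m) = (- 1) ^ Suc m * p ^ (3 * (Suc m)\<^sup>2 - Suc m)"
  proof -
    have "2 * Suc m * Suc m + Suc m * m = 3 * (Suc m)\<^sup>2 - Suc m"
      by (simp add: power2_eq_square)
    then show ?thesis using Q[of m] by (simp add: U_def)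
  qed
  also have "2 * Suc m * Suc m + Suc m * (Suc m + 1) = 3 * (Suc m)\<^sup>2 + Suc m"
    by (simp add: power2_eq_square)
  finally show ?case
    using Suc Q[of "Suc m"] unfolding Q_def[symmetric]
    by (subst sum.lessThan_Suc) (simp only: divide_self nat.distinct if_False, simp add: algebra_simps)
qed simp

text \<open>In Shanks' identity each summand with s at least 1 is at most p ^ n in size, and n p ^ n
  tends to 0. Hence only the summand at s = 0, which is (q;q)_n, survives in the limit.\<close>

theorem pentagonal:
  fixes p :: real
  assumes p: "0 < p" "p < 1"
  shows "(\<lambda>s::nat. if s = 0 then 1 else (- 1) ^ s * (p ^ (3 * s\<^sup>2 - s) + p ^ (3 * s\<^sup>2 + s)))
     sums qpoch_inf (p\<^sup>2) (p\<^sup>2)"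
proof -
  have q: "0 < p\<^sup>2" "p\<^sup>2 < 1" using p by (auto simp: power_less_one_iff)
  define Q where "Q = qpoch (p\<^sup>2) (p\<^sup>2)"
  define F where "F = (\<lambda>n. \<Sum>s\<le>n. (- 1) ^ s * (Q n / Q s) * p ^ (2 * s * n + s * (s + 1)))"
  have bound: "norm (F n - Q n) \<le> real n * p ^ n" for n
  proof -
    have "F n - Q n = (\<Sum>s=1..n. (- 1) ^ s * (Q n / Q s) * p ^ (2 * s * n + s * (s + 1)))"
      unfolding F_def by (subst sum.atMost_shift) (simp add: sum.atLeast1_atMost_eq Q_def)
    also have "norm \<dots> \<le> (\<Sum>s=1..n. p ^ n)"
    proof (rule sum_norm_le)
      fix s assume s: "s \<in> {1..n}"
      have "\<bar>Q n / Q s\<bar> \<le> 1"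
        using qpoch_pos[OF q, of s] qpoch_pos[OF q, of n] qpoch_antimono[OF q, of s n] s by (simp add: Q_def)
      moreover have "p ^ (2 * s * n + s * (s + 1)) \<le> p ^ n"
        using p s by (intro power_decreasing) (auto intro: trans_le_add1)
      ultimately have "\<bar>Q n / Q s\<bar> * p ^ (2 * s * n + s * (s + 1)) \<le> 1 * p ^ n"
        using p by (intro mult_mono) auto
      then show "norm ((- 1) ^ s * (Q n / Q s) * p ^ (2 * s * n + s * (s + 1))) \<le> p ^ n"
        using p by (simp add: abs_mult)
    qed
    finally show ?thesis by simp
  qed
  have "(\<lambda>n. F n - Q n) \<longlonglongrightarrow> 0"
    by (rule Lim_null_comparison[OF always_eventually[OF allI[OF bound]]])
      (use p in \<open>auto intro: powser_times_n_limit_0\<close>)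
  from tendsto_add[OF this qpoch_tendsto[OF q]] have "F \<longlonglongrightarrow> qpoch_inf (p\<^sup>2) (p\<^sup>2)"
    by (simp add: Q_def)
  then show ?thesis
    unfolding sums_def F_def Q_def shanks[OF p] by (rule LIMSEQ_imp_Suc)
qed

text \<open>Completing the square, 3 k^2 + k = 3 (k + 1/6)^2 - 1/12; the last constant becomes the
  factor \<open>exp (pi * t / 12)\<close>. The two pentagonal powers at k are the terms at k and -
  k.\<close>

theorem qpoch_inf_gauss_sum_alt:
  assumes t: "0 < t"
  shows "qpoch_inf (exp (- 2 * pi * t)) (exp (- 2 * pi * t)) = exp (pi * t / 12) * gauss_sum_alt (3 * t) (1 / 6)"
proof -
  define p where "p = exp (- pi * t)"
  have p: "0 < p" "p < 1" using t by (auto simp: p_def)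
  have p2: "p\<^sup>2 = exp (- 2 * pi * t)"
    by (simp add: p_def flip: exp_double)
  define g where "g = (\<lambda>k::int. (- 1) powi k * exp (- pi * (3 * t) * (1 / 6 + real_of_int k)\<^sup>2))"
  have pow: "p ^ n = exp (- pi * t * real n)" for n
    by (simp add: p_def mult.commute flip: exp_of_nat_mult)
  have e: "exp (pi * t / 12) * exp (- pi * (3 * t) * (1 / 6 + x)\<^sup>2) = exp (- pi * t * (3 * x\<^sup>2 + x))" for x
    by (simp add: power2_eq_square algebra_simps add_divide_distrib flip: exp_add)
  have "(\<lambda>k. exp (pi * t / 12) * (if k = 0 then g 0 else g (int k) + g (- int k))) sums
      (exp (pi * t / 12) * gauss_sum_alt (3 * t) (1 / 6))"
    unfolding g_def by (intro sums_mult has_sum_int_imp_sums has_sum_gauss_sum_alt) (use t in simp)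
  moreover have "exp (pi * t / 12) * (if k = 0 then g 0 else g (int k) + g (- int k)) =
      (if k = 0 then 1 else (- 1) ^ k * (p ^ (3 * k\<^sup>2 - k) + p ^ (3 * k\<^sup>2 + k)))" for k
  proof (cases "k = 0")
    case False
    have "real (3 * k\<^sup>2 - k) = 3 * (real k)\<^sup>2 - real k"
      by (subst of_nat_diff) (auto simp: power2_eq_square)
    then have "p ^ (3 * k\<^sup>2 - k) = exp (- pi * t * (3 * (- real k)\<^sup>2 + - real k))"
      "p ^ (3 * k\<^sup>2 + k) = exp (- pi * t * (3 * (real k)\<^sup>2 + real k))"
      unfolding pow by simp_all
    then show ?thesis
      using False unfolding e[symmetric]
      by (simp add: g_def power_int_minus_left algebra_simps)
  next
    case True
    then show ?thesis using e[of 0] by (simp add: g_def)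
  qed
  ultimately show ?thesis
    using pentagonal[OF p] unfolding p2 by (simp add: sums_iff)
qed

subsection \<open>Theta function approximation\<close>

text \<open>The summand is the n-th power of q ^ n * c, and this base is eventually below
  1/2.\<close>

lemma summable_quadratic_power:
  fixes q c :: real
  assumes q: "0 < q" "q < 1" and c: "0 \<le> c"
  shows "summable (\<lambda>n. q ^ (n\<^sup>2) * c ^ n)"
proof -
  have "(\<lambda>n. q ^ n * c) \<longlonglongrightarrow> 0 * c"
    using q by (intro tendsto_intros LIMSEQ_power_zero) auto
  then have "\<forall>\<^sub>F n in sequentially. q ^ n * c < 1 / 2"
    by (intro order_tendstoD) auto
  then have "\<forall>\<^sub>F n in sequentially. norm (q ^ (n\<^sup>2) * c ^ n) \<le> (1 / 2) ^ n"
  proof eventually_elim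
    case (elim n)
    have "(q ^ n * c) ^ n \<le> (1 / 2) ^ n"
      using elim q c by (intro power_mono) auto
    then show ?case using q c by (simp add: power_mult_distrib power2_eq_square power_mult)
  qed
  then show ?thesis by (rule summable_comparison_test_ev) simp
qed

lemma summable_on_theta:
  fixes z :: "'a :: {real_normed_field, banach}"
  assumes q: "0 < q" "q < 1" and z: "z \<noteq> 0"
  shows "(\<lambda>k::int. norm (of_real (q powi (k\<^sup>2)) * z powi k)) summable_on UNIV"
proof (rule summable_on_int)
  have *: "norm (norm (of_real (q powi ((int n)\<^sup>2)) * z powi int n)) = q ^ (n\<^sup>2) * norm z ^ n"
    "norm (norm (of_real (q powi ((- int n)\<^sup>2)) * z powi (- int n))) = q ^ (n\<^sup>2) * inverse (norm z) ^ n" for n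
    using q by (simp_all add: norm_mult norm_power norm_inverse power_int_minus norm_power_int
        power_inverse flip: of_nat_power)
  show "summable (\<lambda>n. norm (norm (of_real (q powi ((int n)\<^sup>2)) * z powi int n)))"
    "summable (\<lambda>n. norm (norm (of_real (q powi ((- int n)\<^sup>2)) * z powi (- int n))))"
    unfolding * by (intro summable_quadratic_power q; simp)+
qed

text \<open>With \<open>k = - j\<close> this is the term of \<open>theta3\<close> at \<open>inverse z * q ^ c\<close>.\<close>

definition sw_term :: "'a::real_normed_field \<Rightarrow> real \<Rightarrow> nat \<Rightarrow> int \<Rightarrow> 'a" where
  "sw_term z q c j = of_real (q powi (j\<^sup>2 - int c * j)) * z powi j"

context
  fixes q :: real and z :: "'a :: {real_normed_field, banach}" and c :: nat
  assumes q: "0 < q" "q < 1" and z: "z \<noteq> 0"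
begin

lemma sw_term_eq:
  "sw_term z q c j = of_real (q powi ((- j)\<^sup>2)) * (inverse z * of_real (q ^ c)) powi (- j)"
proof -
  have "(inverse z * of_real (q ^ c)) powi (- j) = z powi j * of_real ((q powi int c) powi (- j))"
    by (simp add: power_int_mult_distrib power_int_inverse power_int_minus)
  moreover have "q powi (j\<^sup>2 - int c * j) = q powi ((- j)\<^sup>2) * (q powi int c) powi (- j)"
  proof -
    have "(q powi int c) powi (- j) = q powi (- (int c * j))"
      by (simp only: power_int_mult[symmetric] mult_minus_right)
    then show ?thesis using q power_int_add[of q "j\<^sup>2" "- (int c * j)"] by simp
  qed
  ultimately show ?thesis by (simp add: sw_term_def)
qed

lemma norm_sw_term: "norm (sw_term z q c j) = sw_term (norm z) q c j"
  using q by (simp add: sw_term_def norm_mult norm_power_int)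

lemma abs_summable_sw_term: "(\<lambda>j. norm (sw_term z q c j)) summable_on UNIV"
proof -
  have "inverse z * of_real (q ^ c) \<noteq> 0" using q z by simp
  from summable_on_theta[OF q this] show ?thesis unfolding sw_term_eq
    by (subst summable_on_reindex_bij_witness[where i = uminus and j = uminus and T = UNIV]) auto
qed

lemma has_sum_sw_term: "(sw_term z q c has_sum theta3 (inverse z * of_real (q ^ c)) q) UNIV"
proof -
  have "infsum (sw_term z q c) UNIV = theta3 (inverse z * of_real (q ^ c)) q"
    unfolding theta3_def
    by (rule infsum_reindex_bij_witness[where i = uminus and j = uminus]) (auto simp: sw_term_eq)
  moreover have "sw_term z q c summable_on UNIV"
    by (rule abs_summable_summable[OF abs_summable_sw_term])
  ultimately show ?thesis by (metis has_sum_infsum)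
qed

end

lemma theta4_minus: "theta4 w q = theta3 (- w) q"
  unfolding theta4_def theta3_def
  by (intro infsum_cong) (simp add: power_int_minus_left)

lemma has_sum_norm_sw_term:
  fixes z :: "'a :: {real_normed_field, banach}"
  assumes q: "0 < q" "q < 1" and z: "z \<noteq> 0"
  shows "((\<lambda>j. norm (sw_term z q c j)) has_sum theta3 (inverse (norm z) * q ^ c) q) UNIV"
  using has_sum_sw_term[OF q, of "norm z" c] z unfolding norm_sw_term[OF q z] by simp

lemma div_2_chi: "int n = 2 * int (n div 2) + int (chi n)" "chi n \<le> 1"
  unfolding chi_def by linarith+

lemma Suc_div_2_chi: "(n + 1) div 2 = n div 2 + chi n"
  unfolding chi_def by linarith

text \<open>The index \<open>j\<close> is the summation index of \<open>SW\<close> recentred at \<open>n div 2\<close>.\<close>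

definition sw_weight :: "real \<Rightarrow> nat \<Rightarrow> int \<Rightarrow> real" where
  "sw_weight q n j = (let k = int (n div 2) + j in
     if k \<in> {0..int n} then (qpoch_inf q q)\<^sup>2 / (qpoch q q (nat k) * qpoch q q (n - nat k)) else 0)"

text \<open>With k = m + j and n = 2 m + c, the exponent k^2 - n k + m (m + c) equals j^2 - c j;
  this determines the normalising power of \<open>q\<close>. The weight vanishes outside the
  original range, so the finite sum can be compared with a theta series over all integers.\<close>

lemma SW_eq_sw_term:
  fixes z :: "'a :: {real_normed_field, banach}" and n :: nat
  assumes q: "0 < q" "q < 1" and z: "z \<noteq> 0"
  defines "m \<equiv> n div 2" and "c \<equiv> chi n"
  shows "((\<lambda>j. sw_term (- z) q c j * of_real (sw_weight q n j)) has_sum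
    (SW n (z * of_real (q powi (- int n))) q * of_real ((qpoch_inf q q)\<^sup>2 * q ^ (m * (m + c))) / (- z) ^ m)) UNIV"
proof (rule has_sum_finite_neutralI)
  show "finite {- int m..int m + int c}" by simp
  have n: "int n = 2 * int m + int c" using div_2_chi(1)[of n] by (simp add: m_def c_def)
  show "sw_term (- z) q c j * of_real (sw_weight q n j) = 0" if "j \<in> UNIV - {- int m..int m + int c}" for j
    using that n by (auto simp: sw_weight_def Let_def simp flip: m_def)
  have "SW n (z * of_real (q powi (- int n))) q * of_real ((qpoch_inf q q)\<^sup>2 * q ^ (m * (m + c))) / (- z) ^ m
     = (\<Sum>k\<le>n. of_real (q ^ (k\<^sup>2)) * (- (z * of_real (q powi (- int n)))) ^ k / of_real (qpoch q q k * qpoch q q (n - k))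
          * of_real ((qpoch_inf q q)\<^sup>2 * q ^ (m * (m + c))) / (- z) ^ m)"
    unfolding SW_def sum_distrib_right sum_divide_distrib ..
  also have "\<dots> = (\<Sum>j\<in>{- int m..int m + int c}. sw_term (- z) q c j * of_real (sw_weight q n j))"
  proof (rule sum.reindex_bij_witness[where i = "\<lambda>j. nat (int m + j)" and j = "\<lambda>k. int k - int m"])
    fix k assume k: "k \<in> {..n}"
    define j where "j = int k - int m"
    have w: "sw_weight q n j = (qpoch_inf q q)\<^sup>2 / (qpoch q q k * qpoch q q (n - k))"
      using k by (simp add: sw_weight_def Let_def j_def flip: m_def)
    have zj: "(- z) powi j * (- z) ^ m = (- z) ^ k"
    proof -
      have "(- z) powi j * (- z) powi int m = (- z) powi (j + int m)"
        using z by (subst power_int_add) auto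
      then show ?thesis by (simp add: j_def)
    qed
    have qj: "q ^ (k\<^sup>2) * (q powi (- int n)) ^ k * q ^ (m * (m + c)) = q powi (j\<^sup>2 - int c * j)"
    proof -
      have "q ^ (k\<^sup>2) * (q powi (- int n)) ^ k * q ^ (m * (m + c)) =
         q powi (int k)\<^sup>2 * q powi (- int n * int k) * q powi (int m * (int m + int c))"
      proof -
        have "(q powi (- int n)) ^ k = q powi (- int n * int k)"
          by (simp only: power_int_mult power_int_of_nat)
        then show ?thesis by (simp flip: of_nat_power of_nat_mult of_nat_add)
      qed
      also have "\<dots> = q powi ((int k)\<^sup>2 + (- int n * int k) + int m * (int m + int c))"
        using q by (simp only: power_int_add[OF disjI1] less_imp_neq[OF q(1), symmetric] not_False_eq_True)
      also have "(int k)\<^sup>2 + (- int n * int k) + int m * (int m + int c) = j\<^sup>2 - int c * j"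
        unfolding n j_def by (simp add: power2_eq_square algebra_simps)
      finally show ?thesis .
    qed
    have "- (z * of_real (q powi (- int n))) = - z * of_real (q powi (- int n))" by simp
    then have "of_real (q ^ (k\<^sup>2)) * (- (z * of_real (q powi (- int n)))) ^ k
       * of_real (q ^ (m * (m + c))) = of_real (q powi (j\<^sup>2 - int c * j)) * (- z) ^ k"
      unfolding qj[symmetric] by (simp only: power_mult_distrib of_real_mult of_real_power mult_ac)
    then have "of_real (q ^ (k\<^sup>2)) * (- (z * of_real (q powi (- int n)))) ^ k
       * of_real (q ^ (m * (m + c))) = sw_term (- z) q c j * (- z) ^ m"
      unfolding sw_term_def zj[symmetric] by (simp add: mult_ac)
    then have T: "sw_term (- z) q c j = of_real (q ^ (k\<^sup>2)) * (- (z * of_real (q powi (- int n)))) ^ k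
       * of_real (q ^ (m * (m + c))) / (- z) ^ m"
      using z by simp
    have "a * b * d / e * (w / (x * y)) = a * b / (x * y) * (w * d) / e" for a b d e w x y :: 'a
      by (simp add: mult_ac)
    then show "sw_term (- z) q c (int k - int m) * of_real (sw_weight q n (int k - int m)) =
      of_real (q ^ (k\<^sup>2)) * (- (z * of_real (q powi (- int n)))) ^ k / of_real (qpoch q q k * qpoch q q (n - k))
          * of_real ((qpoch_inf q q)\<^sup>2 * q ^ (m * (m + c))) / (- z) ^ m"
      unfolding j_def[symmetric] w T of_real_divide of_real_mult .
  qed (use n in auto)
  finally show "SW n (z * of_real (q powi (- int n))) q * of_real ((qpoch_inf q q)\<^sup>2 * q ^ (m * (m + c))) / (- z) ^ m
     = (\<Sum>j\<in>{- int m..int m + int c}. sw_term (- z) q c j * of_real (sw_weight q n j))" .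
qed auto

text \<open>The weight is a product of two ratios (q;q)_inf / (q;q)_k, each in [0, 1] and within q ^
  (k + 1) / (1 - q) of 1. By 1 - x y <= (1 - x) + (1 - y) the defects add, whence the factor
  2.\<close>

lemma sw_weight_bounds:
  assumes q: "0 < q" "q < 1"
  shows "0 \<le> sw_weight q n j" "sw_weight q n j \<le> 1"
    and "\<bar>j\<bar> < int (n div 4) \<Longrightarrow> 1 - sw_weight q n j \<le> 2 * (q powr (real n / 4) / (1 - q))"
proof -
  define \<rho> where "\<rho> = (\<lambda>k. qpoch_inf q q / qpoch q q k)"
  have \<rho>: "0 \<le> \<rho> k" "\<rho> k \<le> 1" "1 - \<rho> k \<le> q ^ Suc k / (1 - q)" for k
    using qpoch_pos[OF q, of k] qpoch_inf_pos[OF q] qpoch_inf_le[OF q, of k] qpoch_inf_ge[OF q, of k]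
    by (auto simp: \<rho>_def field_simps)
  define k where "k = nat (int (n div 2) + j)"
  have w: "sw_weight q n j = (if int (n div 2) + j \<in> {0..int n} then \<rho> k * \<rho> (n - k) else 0)"
    by (simp add: sw_weight_def Let_def \<rho>_def k_def power2_eq_square)
  show "0 \<le> sw_weight q n j" "sw_weight q n j \<le> 1"
    unfolding w using \<rho> by (auto intro: mult_le_one)
  assume j: "\<bar>j\<bar> < int (n div 4)"
  have in_range: "int (n div 2) + j \<in> {0..int n}" using j by auto
  have pow: "q ^ Suc l / (1 - q) \<le> q powr (real n / 4) / (1 - q)" if "n \<le> 4 * Suc l" for l
  proof -
    have "q ^ Suc l = q powr real (Suc l)" using q by (subst powr_realpow) auto
    also have "\<dots> \<le> q powr (real n / 4)"
      using that q by (intro powr_mono') auto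
    finally show ?thesis using q by (intro divide_right_mono) auto
  qed
  have k: "int k = int (n div 2) + j" "int (n - k) = int n - int k"
    using in_range by (auto simp: k_def)
  have N: "4 * int (n div 4) \<le> int n" by linarith
  \<comment> \<open>Stated for free integers, so that the arithmetic sees no \<open>div\<close>: in
    the middle range both \<open>k\<close> and \<open>n - k\<close> are at least n / 4 - 1.\<close>
  have lin: "n' \<le> 4 * (m' + j' + 1) \<and> n' \<le> 4 * (n' - (m' + j') + 1)"
    if "\<bar>j'\<bar> < N'" "4 * N' \<le> n'" "n' = 2 * m' + x'" "0 \<le> x'" "x' \<le> 1" for n' m' j' N' x' :: int
    using that by (auto simp: abs_less_iff)
  have "int n \<le> 4 * (int k + 1) \<and> int n \<le> 4 * (int (n - k) + 1)"
    unfolding k by (rule lin[OF j N div_2_chi(1)]) (use div_2_chi(2)[of n] in auto)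
  then have "n \<le> 4 * Suc k" "n \<le> 4 * Suc (n - k)"
    by auto
  note bounds = order_trans[OF \<rho>(3) pow[OF this(1)]] order_trans[OF \<rho>(3) pow[OF this(2)]]
  have "1 - \<rho> k * \<rho> (n - k) = (1 - \<rho> k) + \<rho> k * (1 - \<rho> (n - k))" by (simp add: algebra_simps)
  also have "\<dots> \<le> (1 - \<rho> k) + 1 * (1 - \<rho> (n - k))"
    using \<rho>[of k] \<rho>[of "n - k"] by (intro add_left_mono mult_right_mono) auto
  also have "\<dots> \<le> 2 * (q powr (real n / 4) / (1 - q))"
    using bounds by simp
  finally show "1 - sw_weight q n j \<le> 2 * (q powr (real n / 4) / (1 - q))"
    using in_range by (simp add: w)
qed

text \<open>Shifting by N multiplies the term by a constant and by q ^ (2 i N), which is at most 1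
  when i and N have the right signs. A tail is thus a small constant times part of the theta series
  itself. The linear part - c j of the exponent gives opposite signs of c N for the two
  tails.\<close>

lemma sw_term_shift_up:
  assumes q: "0 < q" "q < 1" and z: "0 < z" and i: "0 \<le> i"
  shows "sw_term z q c (i + int N) \<le> z ^ N * q powi (int N ^ 2 - int c * int N) * sw_term z q c i"
proof -
  have "sw_term z q c (i + int N) =
      z ^ N * q powi (int N ^ 2 - int c * int N) * sw_term z q c i * q powi (2 * i * int N)"
  proof -
    have "(i + int N)\<^sup>2 - int c * (i + int N) =
        (int N ^ 2 - int c * int N) + (i\<^sup>2 - int c * i) + 2 * i * int N"
      by (simp add: power2_eq_square algebra_simps)
    then have "q powi ((i + int N)\<^sup>2 - int c * (i + int N)) =
       q powi (int N ^ 2 - int c * int N) * q powi (i\<^sup>2 - int c * i) * q powi (2 * i * int N)"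
      using q by (simp only: power_int_add[OF disjI1] less_imp_neq[OF q(1), symmetric] not_False_eq_True)
    moreover have "z powi (i + int N) = z powi i * z ^ N"
      using z by (simp add: power_int_add)
    ultimately show ?thesis by (simp add: sw_term_def)
  qed
  also have "\<dots> \<le> z ^ N * q powi (int N ^ 2 - int c * int N) * sw_term z q c i * 1"
    using q z i by (intro mult_left_mono) (auto simp: sw_term_def intro!: power_int_le_one)
  finally show ?thesis by simp
qed

lemma sw_term_shift_down:
  assumes q: "0 < q" "q < 1" and z: "0 < z" and i: "i \<le> 0"
  shows "sw_term z q c (i - int N) \<le> q ^ (N\<^sup>2 + c * N) / z ^ N * sw_term z q c i"
proof -
  have "sw_term z q c (i - int N) =
      q ^ (N\<^sup>2 + c * N) / z ^ N * sw_term z q c i * q powi (2 * (- i) * int N)"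
  proof -
    have "(i - int N)\<^sup>2 - int c * (i - int N) =
        int (N\<^sup>2 + c * N) + (i\<^sup>2 - int c * i) + 2 * (- i) * int N"
      by (simp add: power2_eq_square algebra_simps)
    then have "q powi ((i - int N)\<^sup>2 - int c * (i - int N)) =
       q ^ (N\<^sup>2 + c * N) * q powi (i\<^sup>2 - int c * i) * q powi (2 * (- i) * int N)"
      using q by (simp only: power_int_add[OF disjI1] less_imp_neq[OF q(1), symmetric] not_False_eq_True power_int_of_nat)
    moreover have "z powi (i - int N) = z powi i / z ^ N"
      using z by (simp add: power_int_diff)
    ultimately show ?thesis by (simp add: sw_term_def)
  qed
  also have "\<dots> \<le> q ^ (N\<^sup>2 + c * N) / z ^ N * sw_term z q c i * 1"
    using q z i by (intro mult_left_mono) (auto simp: sw_term_def intro!: power_int_le_one mult_nonpos_nonneg)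
  finally show ?thesis by simp
qed

text \<open>The contributions of the middle range, the upper tail and the lower tail, without the
  common theta factor. Keeping them apart allows this factor to be estimated separately when
  \<open>q\<close> varies with \<open>n\<close>.\<close>

definition sw_error :: "real \<Rightarrow> real \<Rightarrow> nat \<Rightarrow> real" where
  "sw_error q r n = 2 * (q powr (real n / 4) / (1 - q))
     + r ^ (n div 4) * q powi (int (n div 4) ^ 2 - int (chi n) * int (n div 4))
     + q ^ ((n div 4)\<^sup>2 + chi n * (n div 4)) / r ^ (n div 4)"

theorem SW_theta_error:
  fixes z :: "'a :: {real_normed_field, banach}"
  assumes q: "0 < q" "q < 1" and z: "z \<noteq> 0"
  shows "norm (SW n (z * of_real (q powi (- int n))) q
      * of_real ((qpoch_inf q q)\<^sup>2 * q ^ ((n div 2) * ((n + 1) div 2))) / (- z) ^ (n div 2)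
      - theta4 (inverse z * of_real (q ^ chi n)) q)
    \<le> theta3 (inverse (norm z) * q ^ chi n) q * sw_error q (norm z) n"
proof -
  define c where "c = chi n"
  define N where "N = n div 4"
  define G where "G = (\<lambda>j. sw_term (norm z) q c j)"
  define \<theta> where "\<theta> = theta3 (inverse (norm z) * q ^ c) q"
  define A B C where "A = 2 * (q powr (real n / 4) / (1 - q))"
    and "B = norm z ^ N * q powi (int N ^ 2 - int c * int N)"
    and "C = q ^ (N\<^sup>2 + c * N) / norm z ^ N"
  define S where "S = SW n (z * of_real (q powi (- int n))) q
      * of_real ((qpoch_inf q q)\<^sup>2 * q ^ ((n div 2) * ((n + 1) div 2))) / (- z) ^ (n div 2)"
  have z': "- z \<noteq> 0" and nz: "0 < norm z" using z by auto
  have G: "norm (sw_term (- z) q c j) = G j" for j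
    using norm_sw_term[OF q z', of c j] by (simp add: G_def)
  have G0: "0 \<le> G j" for j unfolding G[symmetric] by simp
  have sumG: "(G has_sum \<theta>) UNIV"
    using has_sum_norm_sw_term[OF q z', of c] unfolding G by (simp add: \<theta>_def)
  have "((\<lambda>j. sw_term (- z) q c j * of_real (sw_weight q n j)) has_sum S) UNIV"
    using SW_eq_sw_term[OF q z, of n] unfolding S_def c_def Suc_div_2_chi .
  moreover have "theta4 (inverse z * of_real (q ^ chi n)) q = theta3 (inverse (- z) * of_real (q ^ c)) q"
    by (simp add: theta4_minus c_def)
  then have "(sw_term (- z) q c has_sum theta4 (inverse z * of_real (q ^ chi n)) q) UNIV"
    using has_sum_sw_term[OF q z', of c] by simp
  ultimately have diff: "((\<lambda>j. sw_term (- z) q c j * of_real (sw_weight q n j) + - sw_term (- z) q c j)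
      has_sum (S + - theta4 (inverse z * of_real (q ^ chi n)) q)) UNIV"
    by (intro has_sum_add has_sum_uminusI)
  \<comment> \<open>The shifted half series is extended by 0 to all integers, so that the error can
    be dominated termwise over one index set.\<close>
  have up: "((\<lambda>j. if j \<ge> int N then B * G (j - int N) else 0) has_sum (\<Sum>\<^sub>\<infinity>i\<in>{0..}. B * G i)) UNIV"
  proof -
    have "((\<lambda>i. B * G i) has_sum (\<Sum>\<^sub>\<infinity>i\<in>{0..}. B * G i)) {0..}"
      by (intro has_sum_infsum summable_on_cmult_right summable_on_subset_banach[OF has_sum_imp_summable[OF sumG]]) auto
    also have "?this \<longleftrightarrow> ((\<lambda>j. B * G (j - int N)) has_sum (\<Sum>\<^sub>\<infinity>i\<in>{0..}. B * G i)) {int N..}"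
      by (rule has_sum_reindex_bij_witness[where i = "\<lambda>j. j - int N" and j = "\<lambda>i. i + int N"]) auto
    also have "\<dots> \<longleftrightarrow> ?thesis"
      by (rule has_sum_cong_neutral) auto
    finally show ?thesis .
  qed
  have down: "((\<lambda>j. if j \<le> - int N then C * G (j + int N) else 0) has_sum (\<Sum>\<^sub>\<infinity>i\<in>{..0}. C * G i)) UNIV"
  proof -
    have "((\<lambda>i. C * G i) has_sum (\<Sum>\<^sub>\<infinity>i\<in>{..0}. C * G i)) {..0}"
      by (intro has_sum_infsum summable_on_cmult_right summable_on_subset_banach[OF has_sum_imp_summable[OF sumG]]) auto
    also have "?this \<longleftrightarrow> ((\<lambda>j. C * G (j + int N)) has_sum (\<Sum>\<^sub>\<infinity>i\<in>{..0}. C * G i)) {..- int N}"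
      by (rule has_sum_reindex_bij_witness[where i = "\<lambda>j. j + int N" and j = "\<lambda>i. i - int N"]) auto
    also have "\<dots> \<longleftrightarrow> ?thesis"
      by (rule has_sum_cong_neutral) auto
    finally show ?thesis .
  qed
  have ABC: "0 \<le> A" "0 \<le> B" "0 \<le> C"
    using q by (auto simp: A_def B_def C_def)
  have half: "(\<Sum>\<^sub>\<infinity>i\<in>I. D * G i) \<le> D * \<theta>" if "0 \<le> D" for I D
  proof -
    have "(\<Sum>\<^sub>\<infinity>i\<in>I. D * G i) \<le> (\<Sum>\<^sub>\<infinity>i\<in>UNIV. D * G i)"
      using that G0
      by (intro infsum_mono_neutral summable_on_cmult_right summable_on_subset_banach[OF has_sum_imp_summable[OF sumG]]) auto
    also have "\<dots> = D * \<theta>"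
      by (rule infsumI[OF has_sum_cmult_right[OF sumG]])
    finally show ?thesis .
  qed
  have "norm (S + - theta4 (inverse z * of_real (q ^ chi n)) q) \<le>
     A * \<theta> + (\<Sum>\<^sub>\<infinity>i\<in>{0..}. B * G i) + (\<Sum>\<^sub>\<infinity>i\<in>{..0}. C * G i)"
  proof (rule norm_infsum_le[OF diff has_sum_add[OF has_sum_add[OF has_sum_cmult_right[OF sumG] up] down]])
    fix j
    have eq: "norm (sw_term (- z) q c j * of_real (sw_weight q n j) + - sw_term (- z) q c j) = G j * (1 - sw_weight q n j)"
    proof -
      have "sw_term (- z) q c j * of_real (sw_weight q n j) + - sw_term (- z) q c j
         = sw_term (- z) q c j * of_real (sw_weight q n j - 1)"
        by (simp add: algebra_simps)
      then show ?thesis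
        using sw_weight_bounds(2)[OF q, of n j] by (simp only: norm_mult norm_of_real G) simp
    qed
    show "norm (sw_term (- z) q c j * of_real (sw_weight q n j) + - sw_term (- z) q c j) \<le>
      A * G j + (if j \<ge> int N then B * G (j - int N) else 0) + (if j \<le> - int N then C * G (j + int N) else 0)"
    proof (cases "\<bar>j\<bar> < int N")
      case True
      have "G j * (1 - sw_weight q n j) \<le> G j * A"
        using sw_weight_bounds(3)[OF q, of j n] True G0 unfolding A_def N_def by (intro mult_left_mono) auto
      moreover have "\<not> int N \<le> j" "\<not> j \<le> - int N" using True by linarith+
      ultimately show ?thesis unfolding eq by (simp add: mult.commute)
    next
      case False
      have le: "G j * (1 - sw_weight q n j) \<le> G j"
        using sw_weight_bounds(1)[OF q, of n j] G0[of j] by (simp add: mult_left_le)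
      have AG: "0 \<le> A * G j" "0 \<le> B * G (j - int N)" "0 \<le> C * G (j + int N)" using ABC G0 by auto
      show ?thesis
      \<comment> \<open>For \<open>N = 0\<close> the index 0 lies in both tails; this is harmless
        because all terms of the majorant are nonnegative.\<close>
      proof (cases "j \<ge> int N")
        case True
        then have "G j \<le> B * G (j - int N)"
          using sw_term_shift_up[OF q nz, of "j - int N" c N] by (simp add: G_def B_def)
        then show ?thesis unfolding eq using le AG True by auto
      next
        case F: False
        with False have J: "j \<le> - int N" by auto
        then have "G j \<le> C * G (j + int N)"
          using sw_term_shift_down[OF q nz, of "j + int N" c N] by (simp add: G_def C_def)
        then show ?thesis unfolding eq using le AG J F by auto
      qed
    qed
  qed
  also have "\<dots> \<le> A * \<theta> + B * \<theta> + C * \<theta>"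
    using half ABC by (intro add_mono) auto
  also have "\<dots> = \<theta> * sw_error q (norm z) n"
    by (simp add: sw_error_def A_def B_def C_def N_def c_def algebra_simps)
  finally show ?thesis by (simp add: S_def \<theta>_def c_def)
qed

subsection \<open>Asymptotics for \<open>q\<close> tending to 1\<close>

lemma sums_geometric_tail:
  fixes f :: "nat \<Rightarrow> real"
  assumes f: "f sums S" and r: "0 \<le> r" "r < 1" and bound: "\<And>j. 0 < j \<Longrightarrow> \<bar>f j\<bar> \<le> r ^ j"
  shows "\<bar>S - f 0\<bar> \<le> r / (1 - r)"
proof -
  have S: "(\<lambda>j. f (Suc j)) sums (S - f 0)" using f by (subst sums_Suc_iff) simp
  have R: "(\<lambda>j. r ^ Suc j) sums (r / (1 - r))"
    using sums_mult[OF geometric_sums[of r], of r] r by simp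
  have "norm (\<Sum>j. f (Suc j)) \<le> (\<Sum>j. r ^ Suc j)"
  proof (rule norm_suminf_le)
    show "norm (f (Suc n)) \<le> r ^ Suc n" for n
      using bound[of "Suc n"] by (simp only: real_norm_def zero_less_Suc)
  qed (rule sums_summable[OF R])
  then show ?thesis using sums_unique[OF S] sums_unique[OF R] by simp
qed

lemma gauss_sum_approx:
  assumes s: "0 < s"
  shows "\<bar>sqrt s * gauss_sum s x - 1\<bar> \<le> 2 * (exp (- pi / s) / (1 - exp (- pi / s)))"
proof -
  define f where "f = (\<lambda>j. exp (- pi * (real j)\<^sup>2 / s) * cos (2 * pi * real j * x))"
  have "(\<lambda>j. f (Suc j)) sums ((sqrt s * gauss_sum s x - 1) / 2)"
    unfolding f_def by (rule gauss_sum_fourier[OF s])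
  \<comment> \<open>A term at index 0 is put in front so that the wanted sum is a tail to which the
    geometric estimate applies.\<close>
  then have "f sums ((sqrt s * gauss_sum s x - 1) / 2 + f 0)" by (rule sums_Suc)
  then have "\<bar>(sqrt s * gauss_sum s x - 1) / 2 + f 0 - f 0\<bar> \<le> exp (- pi / s) / (1 - exp (- pi / s))"
  proof (rule sums_geometric_tail)
    fix j :: nat assume "0 < j"
    then have "real j \<le> (real j)\<^sup>2" by (simp add: power2_eq_square)
    then have "pi / s * real j \<le> pi / s * (real j)\<^sup>2" using s by (intro mult_left_mono) auto
    then have "exp (- pi * (real j)\<^sup>2 / s) \<le> exp (- pi / s) ^ j"
      by (simp add: mult.commute flip: exp_of_nat_mult)
    moreover have "\<bar>f j\<bar> \<le> exp (- pi * (real j)\<^sup>2 / s) * 1"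
      unfolding f_def abs_mult by (intro mult_mono) auto
    ultimately show "\<bar>f j\<bar> \<le> exp (- pi / s) ^ j" by linarith
  qed (use s in auto)
  then show ?thesis by (simp add: mult.commute)
qed

text \<open>Since (j + 1/2)^2 = j^2 + j + 1/4, removing the leading exponential makes the first term
  exactly cos (pi x) and leaves powers of exp (- pi / s).\<close>

lemma gauss_sum_alt_normalized:
  assumes s: "0 < s"
  shows "(\<lambda>j. exp (- pi / s) ^ (j\<^sup>2 + j) * cos (pi * (2 * real j + 1) * x)) sums
    (exp (pi / (4 * s)) * (sqrt s * gauss_sum_alt s x / 2))"
proof -
  have eq: "exp (pi / (4 * s)) * (exp (- pi * (real j + 1/2)\<^sup>2 / s) * c) = exp (- pi / s) ^ (j\<^sup>2 + j) * c" for j c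
  proof -
    have "pi / (4 * s) + - pi * (real j + 1/2)\<^sup>2 / s = real (j\<^sup>2 + j) * (- pi / s)"
      using s by (simp add: power2_eq_square field_simps)
    then have "exp (pi / (4 * s)) * exp (- pi * (real j + 1/2)\<^sup>2 / s) = exp (- pi / s) ^ (j\<^sup>2 + j)"
      by (simp only: exp_add[symmetric] exp_of_nat_mult)
    then show ?thesis by (simp only: mult.assoc[symmetric])
  qed
  show ?thesis
    using sums_mult[OF gauss_sum_alt_fourier[OF s, of x], of "exp (pi / (4 * s))"] unfolding eq .
qed

lemma gauss_sum_alt_approx:
  assumes t: "0 < t"
  shows "\<bar>exp (pi / (8 * t)) * (sqrt (2 * t) * gauss_sum_alt (2 * t) x / 2) - cos (pi * x)\<bar>
    \<le> exp (- pi / t) / (1 - exp (- pi / t))"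
proof -
  define f where "f = (\<lambda>j. exp (- pi / (2 * t)) ^ (j\<^sup>2 + j) * cos (pi * (2 * real j + 1) * x))"
  have "f sums (exp (pi / (8 * t)) * (sqrt (2 * t) * gauss_sum_alt (2 * t) x / 2))"
    unfolding f_def using gauss_sum_alt_normalized[of "2 * t" x] t by simp
  then have "\<bar>exp (pi / (8 * t)) * (sqrt (2 * t) * gauss_sum_alt (2 * t) x / 2) - f 0\<bar>
      \<le> exp (- pi / t) / (1 - exp (- pi / t))"
  proof (rule sums_geometric_tail)
    fix j :: nat assume j: "0 < j"
    \<comment> \<open>The inequality j^2 + j >= 2 j turns the base at s = 2 t into the ratio exp (-
      pi / t).\<close>
    have "exp (- pi / (2 * t)) ^ (j\<^sup>2 + j) \<le> exp (- pi / (2 * t)) ^ (2 * j)"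
      using j t by (intro power_decreasing) (auto simp: power2_eq_square)
    also have "\<dots> = exp (- pi / t) ^ j"
      by (simp add: power_mult flip: exp_double)
    finally have "exp (- pi / (2 * t)) ^ (j\<^sup>2 + j) \<le> exp (- pi / t) ^ j" .
    moreover have "\<bar>f j\<bar> \<le> exp (- pi / (2 * t)) ^ (j\<^sup>2 + j) * 1"
      unfolding f_def abs_mult by (intro mult_mono) auto
    ultimately show "\<bar>f j\<bar> \<le> exp (- pi / t) ^ j" by linarith
  qed (use t in auto)
  then show ?thesis by (simp add: f_def)
qed

text \<open>The Dedekind eta function at i t divided by its leading behaviour t^(-1/2) exp (- pi /
  (12 t)) as t tends to 0.\<close>

definition eta_ratio :: "real \<Rightarrow> real" where
  "eta_ratio t = qpoch_inf (exp (- 2 * pi * t)) (exp (- 2 * pi * t)) * sqrt t * exp (pi / (12 * t) - pi * t / 12)"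

lemma eta_ratio_pos: "0 < t \<Longrightarrow> 0 < eta_ratio t"
  unfolding eta_ratio_def by (intro mult_pos_pos qpoch_inf_pos) auto

lemma qpoch_inf_eta_ratio:
  assumes "0 < t"
  shows "qpoch_inf (exp (- 2 * pi * t)) (exp (- 2 * pi * t)) = eta_ratio t * exp (pi * t / 12 - pi / (12 * t)) / sqrt t"
proof -
  have "exp (pi / (12 * t) - pi * t / 12) * exp (pi * t / 12 - pi / (12 * t)) = 1"
    by (simp flip: exp_add)
  then show ?thesis using assms by (simp add: eta_ratio_def mult.assoc)
qed

lemma eta_ratio_approx:
  assumes t: "0 < t"
  shows "\<bar>eta_ratio t - 1\<bar> \<le> 2 * (exp (- pi / t) / (1 - exp (- pi / t)))"
proof -
  define f where "f = (\<lambda>j. exp (- pi / (3 * t)) ^ (j\<^sup>2 + j) * cos (pi * (2 * real j + 1) * (1 / 6)))"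
  define X where "X = exp (pi / (12 * t)) * (sqrt (3 * t) * gauss_sum_alt (3 * t) (1 / 6) / 2)"
  have "f sums X"
    unfolding f_def X_def using gauss_sum_alt_normalized[of "3 * t" "1 / 6"] t by simp
  then have 1: "\<bar>X - f 0\<bar> \<le> exp (- pi / t) / (1 - exp (- pi / t))"
  proof (rule sums_geometric_tail)
    fix j :: nat assume j: "0 < j"
    show "\<bar>f j\<bar> \<le> exp (- pi / t) ^ j"
    \<comment> \<open>The term at 1 has too small an exponent for the claimed ratio, but its
      coefficient cos (pi / 2) vanishes. From 2 on, j^2 + j >= 3 j suffices.\<close>
    proof (cases "j = 1")
      case True
      then show ?thesis by (simp add: f_def)
    next
      case False
      have "exp (- pi / (3 * t)) ^ (j\<^sup>2 + j) \<le> exp (- pi / (3 * t)) ^ (3 * j)"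
        using j False t by (intro power_decreasing) (auto simp: power2_eq_square)
      also have "\<dots> = exp (- pi / t) ^ j"
        by (simp add: power_mult flip: exp_of_nat_mult)
      finally have "exp (- pi / (3 * t)) ^ (j\<^sup>2 + j) \<le> exp (- pi / t) ^ j" .
      moreover have "\<bar>f j\<bar> \<le> exp (- pi / (3 * t)) ^ (j\<^sup>2 + j) * 1"
        unfolding f_def abs_mult by (intro mult_mono) auto
      ultimately show ?thesis by linarith
    qed
  qed (use t in auto)
  have "eta_ratio t = gauss_sum_alt (3 * t) (1 / 6) * sqrt t * (exp (pi * t / 12) * exp (pi / (12 * t) - pi * t / 12))"
    unfolding eta_ratio_def qpoch_inf_gauss_sum_alt[OF t] by simp
  also have "exp (pi * t / 12) * exp (pi / (12 * t) - pi * t / 12) = exp (pi / (12 * t))"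
    by (simp flip: exp_add)
  finally have "X = sqrt 3 / 2 * eta_ratio t"
    by (simp add: X_def real_sqrt_mult)
  moreover have "f 0 = sqrt 3 / 2" by (simp add: f_def cos_30)
  ultimately have "X - f 0 = sqrt 3 / 2 * (eta_ratio t - 1)" by (simp add: algebra_simps)
  then have "\<bar>X - f 0\<bar> = sqrt 3 / 2 * \<bar>eta_ratio t - 1\<bar>" by (simp only: abs_mult) simp
  \<comment> \<open>The leading coefficient cos (pi / 6) = sqrt 3 / 2 is at least 1/2, so dividing
    by it at most doubles the error.\<close>
  moreover have "1 / 2 * \<bar>eta_ratio t - 1\<bar> \<le> sqrt 3 / 2 * \<bar>eta_ratio t - 1\<bar>"
    by (intro mult_right_mono) auto
  moreover have "e \<le> 2 * B" if "A = k * e" "1 / 2 * e \<le> k * e" "A \<le> B" for e k A B :: real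
    using that by linarith
  ultimately show ?thesis using 1 by blast
qed

text \<open>Completing the square: - 2 pi t k^2 - 2 pi y k = pi y^2 / (2 t) - 2 pi t (k + y / (2
  t))^2.\<close>

lemma theta_gauss_sum:
  fixes t u :: real and c :: nat
  assumes t: "0 < t"
  defines "w \<equiv> exp (- 2 * pi * u) * exp (- 2 * pi * t) ^ c" and "y \<equiv> u + t * real c"
  shows "theta3 w (exp (- 2 * pi * t)) = exp (pi * y\<^sup>2 / (2 * t)) * gauss_sum (2 * t) (y / (2 * t))"
    and "theta4 w (exp (- 2 * pi * t)) = exp (pi * y\<^sup>2 / (2 * t)) * gauss_sum_alt (2 * t) (y / (2 * t))"
proof -
  have w: "w = exp (- 2 * pi * y)"
    by (simp add: w_def y_def algebra_simps flip: exp_add exp_of_nat_mult)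
  have pw: "exp x powi k = exp (real_of_int k * x)" for x :: real and k :: int
    by (simp add: exp_power_int mult.commute)
  have term_eq: "of_real (exp (- 2 * pi * t) powi k\<^sup>2) * w powi k
     = exp (pi * y\<^sup>2 / (2 * t)) * exp (- pi * (2 * t) * (y / (2 * t) + real_of_int k)\<^sup>2)" for k
  proof -
    have "real_of_int (k\<^sup>2) * (- 2 * pi * t) + real_of_int k * (- 2 * pi * y)
      = pi * y\<^sup>2 / (2 * t) + - pi * (2 * t) * (y / (2 * t) + real_of_int k)\<^sup>2"
      using t by (simp add: power2_eq_square field_simps)
    then show ?thesis unfolding w pw of_real_eq_id id_apply by (simp only: exp_add[symmetric])
  qed
  show "theta3 w (exp (- 2 * pi * t)) = exp (pi * y\<^sup>2 / (2 * t)) * gauss_sum (2 * t) (y / (2 * t))"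
    unfolding theta3_def term_eq gauss_sum_def by (rule infsum_cmult_right')
  have "(- 1) powi k * of_real (exp (- 2 * pi * t) powi k\<^sup>2) * w powi k =
     exp (pi * y\<^sup>2 / (2 * t)) * ((- 1) powi k * exp (- pi * (2 * t) * (y / (2 * t) + real_of_int k)\<^sup>2))" for k
    using term_eq[of k] by (simp add: mult_ac)
  then show "theta4 w (exp (- 2 * pi * t)) = exp (pi * y\<^sup>2 / (2 * t)) * gauss_sum_alt (2 * t) (y / (2 * t))"
    unfolding theta4_def gauss_sum_alt_def by (simp only: infsum_cmult_right')
qed

lemma div_2_mult: "4 * real ((n div 2) * ((n + 1) div 2)) = (real n)\<^sup>2 - real (chi n)"
proof -
  have n: "real n = 2 * real (n div 2) + real (chi n)" using div_2_chi(1)[of n] by linarith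
  have "chi n = 0 \<or> chi n = 1" using div_2_chi(2)[of n] by linarith
  then show ?thesis unfolding n Suc_div_2_chi by (auto simp: power2_eq_square algebra_simps)
qed

text \<open>Completing the square: this is where the parity of \<open>n\<close> drops out.\<close>

lemma exponent_identity:
  assumes t: "0 < t"
  shows "2 * pi * u * real (n div 2) + 2 * pi * t * real ((n div 2) * ((n + 1) div 2))
     + pi * (u + t * real (chi n))\<^sup>2 / (2 * t) = pi * t / 2 * (u / t + real n)\<^sup>2"
proof -
  have "real n = 2 * real (n div 2) + real (chi n)" using div_2_chi(1)[of n] by linarith
  then have m: "real (n div 2) = (real n - real (chi n)) / 2" by simp
  have mm: "real ((n div 2) * ((n + 1) div 2)) = ((real n)\<^sup>2 - real (chi n)) / 4"
    using div_2_mult[of n] by simp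
  have "chi n = 0 \<or> chi n = 1" using div_2_chi(2)[of n] by linarith
  then show ?thesis
    unfolding m mm using t by (auto simp: power2_eq_square field_simps)
qed

text \<open>The exact, nonasymptotic form of the formulas in (ii). The sign \<sigma> treats both
  arguments at once: \<sigma> = 1 leads to the alternating main term, \<sigma> = - 1 to the other.
  In either case the error \<open>b\<close> is bounded through the nonalternating sum.\<close>

lemma SW_core:
  fixes u t \<sigma> :: real and n :: nat
  assumes t: "0 < t" and \<sigma>: "\<sigma> = 1 \<or> \<sigma> = - 1"
  defines "q \<equiv> exp (- 2 * pi * t)" and "x \<equiv> (u + t * real (chi n)) / (2 * t)"
  defines "\<Theta> \<equiv> sqrt (2 * t) * (if \<sigma> = 1 then gauss_sum_alt (2 * t) x else gauss_sum (2 * t) x)"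
  shows "\<exists>b. \<bar>b\<bar> \<le> sqrt (2 * t) * gauss_sum (2 * t) x * sw_error q (exp (2 * pi * u)) n \<and>
    SW n (\<sigma> * exp (2 * pi * t * (u / t + real n))) q =
       (- \<sigma>) ^ (n div 2) * exp (pi * t / 2 * (u / t + real n)\<^sup>2) * sqrt (t / 2) * exp (pi / (6 * t) - pi * t / 6)
       * (\<Theta> + b) / (eta_ratio t)\<^sup>2"
proof -
  have q: "0 < q" "q < 1" using t by (auto simp: q_def)
  define c where "c = chi n"
  define y where "y = u + t * real c"
  define z where "z = \<sigma> * exp (2 * pi * u)"
  define m where "m = n div 2"
  define M where "M = (n div 2) * ((n + 1) div 2)"
  define Y where "Y = exp (pi * y\<^sup>2 / (2 * t))"
  have z: "z \<noteq> 0" "norm z = exp (2 * pi * u)" using \<sigma> by (auto simp: z_def abs_mult)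
  have xy: "x = y / (2 * t)" by (simp add: x_def y_def c_def)
  have iz: "inverse (exp (2 * pi * u)) = exp (- 2 * pi * u)" by (simp add: exp_minus)
  have zq: "z * of_real (q powi (- int n)) = \<sigma> * exp (2 * pi * t * (u / t + real n))"
  proof -
    have "q powi (- int n) = exp (2 * pi * t * real n)"
      unfolding q_def by (simp add: exp_power_int)
    then show ?thesis using t by (simp add: z_def distrib_left exp_add)
  qed
  have \<theta>3: "theta3 (inverse (exp (2 * pi * u)) * q ^ c) q = Y * gauss_sum (2 * t) x"
    unfolding iz Y_def xy y_def q_def by (rule theta_gauss_sum(1)[OF t])
  have \<theta>4: "sqrt (2 * t) * theta4 (inverse z * of_real (q ^ c)) q = Y * \<Theta>"
  proof (cases "\<sigma> = 1")
    case True
    then have "inverse z * of_real (q ^ c) = exp (- 2 * pi * u) * q ^ c" by (simp add: z_def iz)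
    then show ?thesis
      using theta_gauss_sum(2)[OF t, of u c] True unfolding \<Theta>_def Y_def xy y_def q_def by simp
  next
    case False
    then have "- (inverse z * of_real (q ^ c)) = exp (- 2 * pi * u) * q ^ c"
      using \<sigma> iz by (simp add: z_def)
    then show ?thesis
      using theta_gauss_sum(1)[OF t, of u c] False unfolding theta4_minus \<Theta>_def Y_def xy y_def q_def by simp
  qed
  define D where "D = SW n (z * of_real (q powi (- int n))) q
      * of_real ((qpoch_inf q q)\<^sup>2 * q ^ M) / (- z) ^ m
      - theta4 (inverse z * of_real (q ^ c)) q"
  have D: "\<bar>D\<bar> \<le> Y * gauss_sum (2 * t) x * sw_error q (exp (2 * pi * u)) n"
    using SW_theta_error[OF q z(1), of n] unfolding D_def m_def M_def c_def[symmetric] z(2) \<theta>3 by simp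
  \<comment> \<open>The error \<open>D\<close> in the scale of \<Theta>: \<open>Y\<close> is the
    factor that completing the square has pulled out of the theta functions.\<close>
  define b where "b = sqrt (2 * t) * D / Y"
  have Y0: "0 < Y" by (simp add: Y_def)
  have "\<bar>b\<bar> = sqrt (2 * t) * \<bar>D\<bar> / Y" using t Y0 by (simp add: b_def abs_mult)
  also have "\<dots> \<le> sqrt (2 * t) * (Y * gauss_sum (2 * t) x * sw_error q (exp (2 * pi * u)) n) / Y"
    using D t Y0 by (intro divide_right_mono mult_left_mono) auto
  also have "\<dots> = sqrt (2 * t) * gauss_sum (2 * t) x * sw_error q (exp (2 * pi * u)) n"
    using Y0 by simp
  finally have b: "\<bar>b\<bar> \<le> sqrt (2 * t) * gauss_sum (2 * t) x * sw_error q (exp (2 * pi * u)) n" .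
  define W where "W = SW n (\<sigma> * exp (2 * pi * t * (u / t + real n))) q"
  have Q: "qpoch_inf q q = eta_ratio t * exp (pi * t / 12 - pi / (12 * t)) / sqrt t"
    unfolding q_def by (rule qpoch_inf_eta_ratio[OF t])
  have Q2: "(qpoch_inf q q)\<^sup>2 = (eta_ratio t)\<^sup>2 * exp (- (pi / (6 * t) - pi * t / 6)) / t"
    unfolding Q using t by (simp add: power_divide power_mult_distrib flip: exp_double)
  have "Y * b = sqrt (2 * t) * D" using Y0 by (simp add: b_def)
  then have "Y * (\<Theta> + b) = sqrt (2 * t) * (theta4 (inverse z * of_real (q ^ c)) q + D)"
    using \<theta>4 by (simp only: distrib_left)
  also have "theta4 (inverse z * of_real (q ^ c)) q + D = W * ((qpoch_inf q q)\<^sup>2 * q ^ M) / (- z) ^ m"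
    unfolding D_def zq W_def by simp
  finally have "Y * (\<Theta> + b) = sqrt (2 * t) * (W * ((qpoch_inf q q)\<^sup>2 * q ^ M) / (- z) ^ m)" .
  moreover have "w = A * p / (r * x * y)" if "A = r * (w * (x * y) / p)" "r \<noteq> 0" "x \<noteq> 0" "y \<noteq> 0" "p \<noteq> 0"
    for A r w x y p :: real
    unfolding that(1) using that(2-) by simp
  ultimately have "W = Y * (\<Theta> + b) * (- z) ^ m / (sqrt (2 * t) * (qpoch_inf q q)\<^sup>2 * q ^ M)"
    using z(1) t q qpoch_inf_pos[OF q] by simp
  also have "\<dots> = (- \<sigma>) ^ m * (exp (2 * pi * u * real m) * exp (2 * pi * t * real M) * Y)
      * (t / sqrt (2 * t)) * exp (pi / (6 * t) - pi * t / 6) * (\<Theta> + b) / (eta_ratio t)\<^sup>2"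
  proof -
    have "(- z) ^ m = ((- \<sigma>) * exp (2 * pi * u)) ^ m" by (simp add: z_def)
    also have "\<dots> = (- \<sigma>) ^ m * exp (2 * pi * u) ^ m" by (rule power_mult_distrib)
    also have "exp (2 * pi * u) ^ m = exp (2 * pi * u * real m)"
      by (simp add: mult.commute flip: exp_of_nat_mult)
    finally have zm: "(- z) ^ m = (- \<sigma>) ^ m * exp (2 * pi * u * real m)" .
    have qM: "q ^ M = 1 / exp (2 * pi * t * real M)"
    proof -
      have "real M * (- 2 * pi * t) = - (2 * pi * t * real M)" by simp
      then show ?thesis unfolding q_def exp_of_nat_mult[symmetric]
        by (simp only: exp_minus inverse_eq_divide)
    qed
    \<comment> \<open>Free variables keep the exponentials opaque while denominators are
      cleared.\<close>
    have "y * B * (s * e1) / (r * (E2 * (1 / ev) / t) * (1 / ew)) = s * (e1 * ew * y) * (t / r) * ev * B / E2"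
      if "ev \<noteq> 0" "ew \<noteq> 0" for y B s e1 r E2 ev ew :: real
      using that by simp
    then show ?thesis
      unfolding zm qM Q2 exp_minus[of "pi / (6 * t) - pi * t / 6"] inverse_eq_divide by simp
  qed
  also have "exp (2 * pi * u * real m) * exp (2 * pi * t * real M) * Y = exp (pi * t / 2 * (u / t + real n)\<^sup>2)"
    unfolding Y_def exp_add[symmetric] m_def M_def y_def c_def exponent_identity[OF t] ..
  also have "t / sqrt (2 * t) = sqrt (t / 2)"
    using t by (simp add: real_sqrt_mult real_sqrt_divide real_div_sqrt)
      (simp add: field_simps)
  finally show ?thesis using b unfolding W_def m_def by blast
qed

section \<open>Error calculus for factors close to 1\<close>

lemma bigo_eventually_le:
  fixes f g :: "nat \<Rightarrow> real"
  assumes "\<forall>\<^sub>F n in sequentially. \<bar>f n\<bar> \<le> g n" and "g \<in> O(h)"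
  shows "f \<in> O(h)"
proof -
  have "f \<in> O(g)"
    by (rule bigoI[where c = 1]) (use assms(1) in eventually_elim, auto)
  then show ?thesis using assms(2) landau_o.big_trans by blast
qed

lemma bigo_geometric_ratio:
  fixes r :: "nat \<Rightarrow> real"
  assumes "r \<longlonglongrightarrow> 0"
  shows "(\<lambda>n. r n / (1 - r n)) \<in> O(r)"
proof -
  have "(\<lambda>n. 1 / (1 - r n)) \<longlonglongrightarrow> 1 / (1 - 0)"
    by (intro tendsto_intros assms) simp
  then have "(\<lambda>n. 1 / (1 - r n)) \<in> O(\<lambda>_. 1)"
    by (intro bigoI_tendsto[where c = 1]) auto
  from landau_o.big_1_mult[OF landau_o.big_refl this, of r] show ?thesis by simp
qed

lemma bigo_imp_tendsto:
  fixes f g :: "nat \<Rightarrow> real"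
  assumes "(\<lambda>n. f n - 1) \<in> O(g)" "g \<longlonglongrightarrow> 0"
  shows "f \<longlonglongrightarrow> 1"
proof -
  have "g \<in> o(\<lambda>_. 1)" using assms(2) by (intro smalloI_tendsto) auto
  then have "(\<lambda>n. f n - 1) \<in> o(\<lambda>_. 1)" using assms(1) by (rule landau_o.big_small_trans[rotated])
  then have "(\<lambda>n. f n - 1) \<longlonglongrightarrow> 0" using smalloD_tendsto by fastforce
  from tendsto_add[OF this tendsto_const[of 1]] show ?thesis by simp
qed

lemma near_one_mult:
  fixes f h g :: "nat \<Rightarrow> real"
  assumes f: "(\<lambda>n. f n - 1) \<in> O(g)" and h: "(\<lambda>n. h n - 1) \<in> O(g)" and g: "g \<longlonglongrightarrow> 0"
  shows "(\<lambda>n. f n * h n - 1) \<in> O(g)"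
proof -
  have "h \<in> O(\<lambda>_. 1)"
    using bigo_imp_tendsto[OF h g] by (intro bigoI_tendsto[where c = 1]) auto
  from sum_in_bigo(1)[OF landau_o.big_1_mult[OF f this] h] show ?thesis
    by (simp add: algebra_simps)
qed

lemma near_one_inverse:
  fixes f g :: "nat \<Rightarrow> real"
  assumes f: "(\<lambda>n. f n - 1) \<in> O(g)" and g: "g \<longlonglongrightarrow> 0"
  shows "(\<lambda>n. 1 / f n - 1) \<in> O(g)"
proof -
  have lim: "f \<longlonglongrightarrow> 1" by (rule bigo_imp_tendsto[OF f g])
  then have "(\<lambda>n. - (1 / f n)) \<longlonglongrightarrow> - (1 / 1)" by (intro tendsto_intros) auto
  then have "(\<lambda>n. - (1 / f n)) \<in> O(\<lambda>_. 1)" by (intro bigoI_tendsto[where c = "- 1"]) auto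
  from landau_o.big_1_mult[OF f this] have "(\<lambda>n. (f n - 1) * - (1 / f n)) \<in> O(g)" .
  moreover have "\<forall>\<^sub>F n in sequentially. f n > 0" using order_tendstoD(1)[OF lim] by simp
  then have "\<forall>\<^sub>F n in sequentially. (f n - 1) * - (1 / f n) = 1 / f n - 1"
    by eventually_elim (simp add: field_simps)
  ultimately show ?thesis by (simp cong: landau_o.big.in_cong)
qed

lemma near_one_sqrt:
  fixes f g :: "nat \<Rightarrow> real"
  assumes f: "(\<lambda>n. f n - 1) \<in> O(g)" and pos: "\<forall>\<^sub>F n in sequentially. 0 \<le> f n"
  shows "(\<lambda>n. sqrt (f n) - 1) \<in> O(g)"
proof (rule bigo_eventually_le[OF _ f[THEN landau_o.big.abs_in_iff[THEN iffD2]]])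
  show "\<forall>\<^sub>F n in sequentially. \<bar>sqrt (f n) - 1\<bar> \<le> \<bar>f n - 1\<bar>"
    using pos
  proof eventually_elim
    case (elim n)
    have "f n - 1 = (sqrt (f n) - 1) * (sqrt (f n) + 1)"
      using elim by (simp add: algebra_simps)
    then have "\<bar>f n - 1\<bar> = \<bar>sqrt (f n) - 1\<bar> * (sqrt (f n) + 1)"
      using elim by (simp add: abs_mult)
    moreover have "\<bar>sqrt (f n) - 1\<bar> * 1 \<le> \<bar>sqrt (f n) - 1\<bar> * (sqrt (f n) + 1)"
      using elim by (intro mult_left_mono) auto
    ultimately show ?case by simp
  qed
qed

text \<open>For main terms that may vanish, such as the cosine. A factor k near 1 turns the additive
  error into (k - 1) c + \<rho> k, which has the same order because c is bounded.\<close>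

lemma near_one_perturb:
  fixes k \<rho> c g :: "nat \<Rightarrow> real"
  assumes k: "(\<lambda>n. k n - 1) \<in> O(g)" and \<rho>: "\<rho> \<in> O(g)" and g: "g \<longlonglongrightarrow> 0" and c: "\<And>n. \<bar>c n\<bar> \<le> 1"
  shows "(\<lambda>n. (c n + \<rho> n) * k n - c n) \<in> O(g)"
proof -
  have "k \<in> O(\<lambda>_. 1)"
    using bigo_imp_tendsto[OF k g] by (intro bigoI_tendsto[where c = 1]) auto
  moreover have "c \<in> O(\<lambda>_. 1)" using c by (intro bigoI[where c = 1]) auto
  ultimately have "(\<lambda>n. (k n - 1) * c n + \<rho> n * k n) \<in> O(g)"
    by (intro sum_in_bigo(1) landau_o.big_1_mult[OF k] landau_o.big_1_mult[OF \<rho>])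
  then show ?thesis by (simp add: algebra_simps)
qed

lemma cos_add_npi: "cos (x + pi * real m) = (- 1) ^ m * cos x"
  by (simp add: cos_add)

text \<open>The middle term is exp (- pi n powr (1 - a) / 2) up to the factor 1 / (1 - q), and beats
  the target because 1 - a > a. The tails are far smaller, of size exp (- 2 pi t N^2) with N near n
  / 4, up to lower order terms in the exponent.\<close>

lemma sw_error_bigo:
  fixes a u :: real
  assumes a: "0 < a" "a < 1 / 2"
  shows "(\<lambda>n. sw_error (exp (- 2 * pi * real n powr (- a))) (exp (2 * pi * u)) n)
    \<in> O(\<lambda>n. exp (- 2 * pi * real n powr a))"
proof -
  define t where "t = (\<lambda>n. real n powr (- a))"
  define q where "q = (\<lambda>n. exp (- 2 * pi * t n))"
  define h where "h = (\<lambda>n. exp (- 2 * pi * real n powr a))"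
  have tpos: "\<forall>\<^sub>F n in sequentially. 0 < t n"
    using eventually_gt_at_top[of 0] by eventually_elim (simp add: t_def)
  have 1: "(\<lambda>n. 2 * (q n powr (real n / 4) / (1 - q n))) \<in> O(h)"
  proof (rule bigo_eventually_le)
    show "(\<lambda>n. 2 * (exp (- pi * real n powr (1 - a) / 2) * (1 + real n powr a / (2 * pi)))) \<in> O(h)"
      using a unfolding h_def by real_asymp
    show "\<forall>\<^sub>F n in sequentially. \<bar>2 * (q n powr (real n / 4) / (1 - q n))\<bar>
       \<le> 2 * (exp (- pi * real n powr (1 - a) / 2) * (1 + real n powr a / (2 * pi)))"
      using eventually_gt_at_top[of 0]
    proof eventually_elim
      case (elim n)
      have t: "0 < t n" and it: "1 / t n = real n powr a" and tn: "t n * real n = real n powr (1 - a)"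
        using elim by (simp_all add: t_def powr_minus powr_diff field_simps)
      have q: "0 < q n" "q n < 1" using t by (auto simp: q_def)
      \<comment> \<open>As q tends to 1, this keeps 1 / (1 - q) linear in n powr a.\<close>
      have "1 + 2 * pi * t n \<le> exp (2 * pi * t n)" by (rule exp_ge_add_one_self)
      then have "1 / exp (2 * pi * t n) \<le> 1 / (1 + 2 * pi * t n)"
        using t add_pos_pos[of 1 "2 * pi * t n"] by (intro frac_le) auto
      then have "q n \<le> 1 / (1 + 2 * pi * t n)" by (simp add: q_def exp_minus inverse_eq_divide)
      then have "2 * pi * t n / (1 + 2 * pi * t n) \<le> 1 - q n"
      proof -
        have "2 * pi * t n / (1 + 2 * pi * t n) = 1 - 1 / (1 + 2 * pi * t n)"
          using t add_pos_pos[of 1 "2 * pi * t n"] by (simp add: diff_divide_eq_iff)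
        then show ?thesis using \<open>q n \<le> _\<close> by linarith
      qed
      moreover have "0 < 2 * pi * t n / (1 + 2 * pi * t n)"
        using t add_pos_pos[of 1 "2 * pi * t n"] by simp
      ultimately have "1 / (1 - q n) \<le> 1 / (2 * pi * t n / (1 + 2 * pi * t n))"
        by (intro frac_le) auto
      also have "\<dots> = 1 + 1 / t n / (2 * pi)" using t by (simp add: field_simps)
      finally have "1 / (1 - q n) \<le> 1 + real n powr a / (2 * pi)" unfolding it .
      moreover have "q n powr (real n / 4) = exp (- pi * real n powr (1 - a) / 2)"
        unfolding tn[symmetric] by (simp add: q_def powr_def field_simps)
      ultimately have "q n powr (real n / 4) * (1 / (1 - q n)) \<le>
         exp (- pi * real n powr (1 - a) / 2) * (1 + real n powr a / (2 * pi))"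
        by (intro mult_mono) (use q in auto)
      then show ?case using q by simp
    qed
  qed
  have "filterlim (\<lambda>n::nat. real n powr (- a) * (real n / 4 - 1)) at_top sequentially"
    using a by real_asymp
  then have ev1: "\<forall>\<^sub>F n in sequentially. \<bar>u\<bar> + 2 \<le> real n powr (- a) * (real n / 4 - 1)"
    by (simp add: filterlim_at_top)
  have ev2: "\<forall>\<^sub>F n::nat in sequentially. real n powr a \<le> real n / 4 - 1"
    using a by real_asymp
  have ev3: "\<forall>\<^sub>F n::nat in sequentially. real n powr (- a) \<le> 1"
    using a by real_asymp
  have key: "\<forall>\<^sub>F n in sequentially.
      exp (2 * pi * u) ^ (n div 4) * q n powi (int (n div 4) ^ 2 - int (chi n) * int (n div 4)) \<le> h n
      \<and> q n ^ ((n div 4)\<^sup>2 + chi n * (n div 4)) / exp (2 * pi * u) ^ (n div 4) \<le> h n"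
    using ev1 ev2 ev3 tpos
  proof eventually_elim
    case (elim n)
    define N where "N = real (n div 4)"
    define c where "c = real (chi n)"
    have N: "real n / 4 - 1 \<le> N" unfolding N_def by linarith
    have c: "0 \<le> c" "c \<le> 1" using div_2_chi(2)[of n] by (auto simp: c_def)
    have N0: "real n powr a \<le> N" "0 \<le> N" using elim N by (auto simp: N_def)
    have "t n * (real n / 4 - 1) \<le> t n * N" using N elim by (intro mult_left_mono) auto
    with elim(1) have tN: "\<bar>u\<bar> + 2 \<le> t n * N" unfolding t_def by (rule order_trans)
    have tc: "t n * c \<le> 1" "0 \<le> t n * c" using elim c by (auto simp: t_def intro: mult_le_one)
    \<comment> \<open>The reserve 2 in \<open>tN\<close> is split: one unit absorbs the parity term
      \<open>d\<close>, the other leaves a factor of at most - 1, and \<open>N\<close> exceeds n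
      powr a.\<close>
    have main: "N * (v - t n * N + d) \<le> - (real n powr a)" if "v \<le> \<bar>u\<bar>" "d \<le> 1" for v d
    proof -
      have "N * (v - t n * N + d) \<le> N * (- 1)"
        using that tN N0 by (intro mult_left_mono) auto
      then show ?thesis using N0 by simp
    qed
    have "exp (2 * pi * u) ^ (n div 4) * q n powi (int (n div 4) ^ 2 - int (chi n) * int (n div 4))
       = exp (2 * pi * (N * (u - t n * N + t n * c)))"
    proof -
      have "exp (2 * pi * u) ^ (n div 4) = exp (N * (2 * pi * u))"
        unfolding N_def by (rule exp_of_nat_mult[symmetric])
      moreover have "q n powi (int (n div 4) ^ 2 - int (chi n) * int (n div 4)) = exp ((N\<^sup>2 - c * N) * (- 2 * pi * t n))"
        by (simp add: q_def exp_power_int N_def c_def)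
      moreover have "N * (2 * pi * u) + (N\<^sup>2 - c * N) * (- 2 * pi * t n) = 2 * pi * (N * (u - t n * N + t n * c))"
        by (simp add: power2_eq_square algebra_simps)
      ultimately show ?thesis by (simp only: exp_add[symmetric])
    qed
    also have "\<dots> \<le> exp (2 * pi * (- (real n powr a)))"
      by (intro exp_le_cancel_iff[THEN iffD2] mult_left_mono main) (use tc in auto)
    finally have A: "exp (2 * pi * u) ^ (n div 4) * q n powi (int (n div 4) ^ 2 - int (chi n) * int (n div 4)) \<le> h n"
      by (simp add: h_def)
    have "q n ^ ((n div 4)\<^sup>2 + chi n * (n div 4)) / exp (2 * pi * u) ^ (n div 4)
       = exp (2 * pi * (N * (- u - t n * N + - (t n * c))))"
    proof -
      have "exp (2 * pi * u) ^ (n div 4) = exp (N * (2 * pi * u))"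
        unfolding N_def by (rule exp_of_nat_mult[symmetric])
      moreover have "q n ^ ((n div 4)\<^sup>2 + chi n * (n div 4)) = exp ((N\<^sup>2 + c * N) * (- 2 * pi * t n))"
        unfolding q_def exp_of_nat_mult[symmetric] by (simp add: N_def c_def)
      moreover have "(N\<^sup>2 + c * N) * (- 2 * pi * t n) - N * (2 * pi * u) = 2 * pi * (N * (- u - t n * N + - (t n * c)))"
        by (simp add: power2_eq_square algebra_simps)
      ultimately show ?thesis by (simp only: exp_diff[symmetric])
    qed
    also have "\<dots> \<le> exp (2 * pi * (- (real n powr a)))"
      by (intro exp_le_cancel_iff[THEN iffD2] mult_left_mono main) (use tc in auto)
    finally show ?case using A by (simp add: h_def)
  qed
  have 2: "(\<lambda>n. exp (2 * pi * u) ^ (n div 4) * q n powi (int (n div 4) ^ 2 - int (chi n) * int (n div 4))) \<in> O(h)"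
    by (rule bigo_eventually_le[OF _ landau_o.big_refl], use key in eventually_elim) (auto simp: q_def abs_mult)
  have 3: "(\<lambda>n. q n ^ ((n div 4)\<^sup>2 + chi n * (n div 4)) / exp (2 * pi * u) ^ (n div 4)) \<in> O(h)"
    by (rule bigo_eventually_le[OF _ landau_o.big_refl], use key in eventually_elim) (auto simp: q_def)
  from sum_in_bigo(1)[OF sum_in_bigo(1)[OF 1 2] 3] show ?thesis
    unfolding sw_error_def q_def t_def h_def .
qed

text \<open>In the exponents of the weight and of the polynomial the squares of u + t n cancel; what
  remains is linear and gives the stated exponentials. Replacing (q;q)_n by (q;q)_inf leaves the
  square root as the only factor that is not explicit.\<close>

lemma sw_fun_prefactor:
  fixes t u :: real and n :: nat
  assumes t: "0 < t"
  defines "q \<equiv> exp (- 2 * pi * t)"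
  shows "sqrt (q ^ n * qpoch q q n * w_sw (exp (2 * pi * t * (u / t + real n))) q)
      * (sqrt (2 * t) * exp (pi * t / 2 * (u / t + real n)\<^sup>2) * exp (pi / (24 * t) - pi * t / 6))
    = sqrt (eta_ratio t * (qpoch q q n / qpoch_inf q q)) * exp (- pi * u / 2)
      / (sqrt pi * exp (3 * pi * (t * real n) / 2 + pi * t / 4))"
proof -
  have q: "0 < q" "q < 1" using t by (auto simp: q_def)
  define V where "V = qpoch q q n / qpoch_inf q q"
  define L where "L = - 2 * pi * t * real n + (pi * t / 12 - pi / (12 * t)) + - pi / (4 * t) * (2 * u + 2 * t * real n + t)\<^sup>2"
  have V: "0 < V" using qpoch_pos[OF q] qpoch_inf_pos[OF q] by (simp add: V_def)
  have lnq: "ln q = - 2 * pi * t" by (simp add: q_def)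
  have tx: "2 * pi * t * (u / t + real n) = 2 * pi * (u + t * real n)" using t by (simp add: field_simps)
  have sq: "sqrt q = exp (- pi * t)"
    by (rule real_sqrt_unique) (simp_all add: q_def flip: exp_double)
  have "exp (2 * pi * t * (u / t + real n)) / sqrt q = exp (2 * pi * (u + t * real n) + pi * t)"
    unfolding tx sq by (simp add: exp_add exp_minus field_simps)
  then have "ln (exp (2 * pi * t * (u / t + real n)) / sqrt q) = 2 * pi * (u + t * real n) + pi * t"
    by (simp only: ln_exp)
  also have "\<dots> = pi * (2 * u + 2 * t * real n + t)" by (simp add: algebra_simps)
  finally have "1 / (2 * ln q) * (ln (exp (2 * pi * t * (u / t + real n)) / sqrt q))\<^sup>2
      = - pi / (4 * t) * (2 * u + 2 * t * real n + t)\<^sup>2"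
    unfolding lnq using t by (simp add: power_mult_distrib) (simp add: power2_eq_square)
  moreover have "sqrt (- 1 / (2 * pi * ln q)) = 1 / (2 * pi * sqrt t)"
  proof (rule real_sqrt_unique)
    show "(1 / (2 * pi * sqrt t))\<^sup>2 = - 1 / (2 * pi * ln q)"
      unfolding lnq using t by (simp add: power_divide power_mult_distrib) (simp add: power2_eq_square)
  qed (use t in simp)
  ultimately have w: "w_sw (exp (2 * pi * t * (u / t + real n))) q =
      1 / (2 * pi * sqrt t) * exp (- pi / (4 * t) * (2 * u + 2 * t * real n + t)\<^sup>2)"
    by (simp only: w_sw_def)
  have "qpoch q q n = V * qpoch_inf q q" using qpoch_inf_pos[OF q] by (simp add: V_def)
  then have Qn: "qpoch q q n = V * (eta_ratio t * exp (pi * t / 12 - pi / (12 * t)) / sqrt t)"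
    unfolding q_def qpoch_inf_eta_ratio[OF t] .
  have qn: "q ^ n = exp (- 2 * pi * t * real n)"
    unfolding q_def by (simp add: mult_ac flip: exp_of_nat_mult)
  have "x * (V * (E * y / r)) * (1 / (2 * pi * r) * z) = E * V * (x * y * z) / (2 * pi * (r * r))"
    for x y z E r :: real
    by (simp add: mult_ac)
  then have "q ^ n * qpoch q q n * w_sw (exp (2 * pi * t * (u / t + real n))) q =
     eta_ratio t * V * exp L / (2 * pi * t)"
    unfolding qn Qn w L_def exp_add using t by (simp only: real_sqrt_mult_self abs_of_pos)
  then have "sqrt (q ^ n * qpoch q q n * w_sw (exp (2 * pi * t * (u / t + real n))) q) =
     sqrt (eta_ratio t * V) * exp (L / 2) / (sqrt pi * sqrt (2 * t))"
  proof -
    have "sqrt (exp L) = exp (L / 2)"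
      by (rule real_sqrt_unique) (simp_all flip: exp_double)
    then show ?thesis
      unfolding \<open>q ^ n * qpoch q q n * _ = _\<close> by (simp add: real_sqrt_mult real_sqrt_divide)
  qed
  then have "sqrt (q ^ n * qpoch q q n * w_sw (exp (2 * pi * t * (u / t + real n))) q)
      * (sqrt (2 * t) * exp (pi * t / 2 * (u / t + real n)\<^sup>2) * exp (pi / (24 * t) - pi * t / 6))
     = sqrt (eta_ratio t * V) / sqrt pi *
       (exp (L / 2) * exp (pi * t / 2 * (u / t + real n)\<^sup>2) * exp (pi / (24 * t) - pi * t / 6))"
    using t by simp
  also have "exp (L / 2) * exp (pi * t / 2 * (u / t + real n)\<^sup>2) * exp (pi / (24 * t) - pi * t / 6)
     = exp (- pi * u / 2) / exp (3 * pi * (t * real n) / 2 + pi * t / 4)"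
  proof -
    have "L / 2 + pi * t / 2 * (u / t + real n)\<^sup>2 + (pi / (24 * t) - pi * t / 6)
      = - pi * u / 2 - (3 * pi * (t * real n) / 2 + pi * t / 4)"
      unfolding L_def using t by (simp add: power2_eq_square field_simps)
    then show ?thesis by (simp only: exp_add[symmetric] exp_diff[symmetric])
  qed
  finally show ?thesis by (simp add: V_def)
qed

text \<open>The bound is chosen to match the first part of \<open>sw_error\<close>, so that its
  asymptotics need not be redone.\<close>

lemma qpoch_ratio_bound:
  assumes q: "0 < q" "q < 1"
  shows "\<bar>qpoch_inf q q / qpoch q q n - 1\<bar> \<le> q powr (real n / 4) / (1 - q)"
proof -
  have "qpoch_inf q q / qpoch q q n \<le> 1" "1 - q ^ Suc n / (1 - q) \<le> qpoch_inf q q / qpoch q q n"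
    using qpoch_pos[OF q, of n] qpoch_inf_le[OF q, of n] qpoch_inf_ge[OF q, of n]
    by (auto simp: le_divide_eq mult.commute)
  moreover have "q ^ Suc n = q powr real (Suc n)" using q by (subst powr_realpow) auto
  then have "q ^ Suc n \<le> q powr (real n / 4)" using q by (auto intro: powr_mono')
  then have "q ^ Suc n / (1 - q) \<le> q powr (real n / 4) / (1 - q)"
    using q by (intro divide_right_mono) auto
  ultimately show ?thesis by linarith
qed

lemma SW_asymptotics:
  fixes a u :: real
  assumes a: "0 < a" "a < 1 / 2"
  shows "(\<exists>r. r \<in> O(\<lambda>n. exp (- pi * real n powr a / 2)) \<and>
         (\<forall>n\<ge>1.
            SW n (- exp (2 * pi * real n powr (- a) * (real n powr a * u + real n)))
                 (exp (- 2 * pi * real n powr (- a))) =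
            exp (pi * real n powr (- a) * (real n powr a * u + real n)\<^sup>2 / 2) * (1 + r n)
            / (sqrt (2 * real n powr a)
               * exp (pi * real n powr (- a) / 6 - pi * real n powr a / 6))))" (is ?A)
    and "(\<exists>r. r \<in> O(\<lambda>n. exp (- pi * real n powr a)) \<and>
         (\<forall>n\<ge>1.
            SW n (exp (2 * pi * real n powr (- a) * (real n powr a * u + real n)))
                 (exp (- 2 * pi * real n powr (- a))) =
            sqrt (2 / real n powr a)
            * (exp (pi * real n powr (- a) / 2 * (real n powr a * u + real n)\<^sup>2)
               * (cos (pi / 2 * (real n powr a * u + real n)) + r n)
               / exp (pi * real n powr (- a) / 6 - pi * real n powr a / 24))))" (is ?B)
    and "(\<exists>r. r \<in> O(\<lambda>n. exp (- pi * real n powr a)) \<and>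
         (\<forall>n\<ge>1.
            sw_fun n (exp (2 * pi * real n powr (- a) * (real n powr a * u + real n)))
                     (exp (- 2 * pi * real n powr (- a))) =
            exp (- pi * u / 2)
            * (cos (pi / 2 * (real n powr a * u + real n)) + r n)
            / (sqrt pi
               * exp (3 * pi * real n powr (1 - a) / 2 + pi * real n powr (- a) / 4))))" (is ?C)
proof -
  define t where "t = (\<lambda>n. real n powr (- a))"
  define T where "T = (\<lambda>n. real n powr a)"
  define q where "q = (\<lambda>n. exp (- 2 * pi * t n))"
  \<comment> \<open>As \<open>T n\<close> is 1 / t n, \<open>h\<close> is the accuracy exp (- pi /
    (2 t)) of the nonalternating sum at 2 t, and \<open>g\<close> the accuracy exp (- pi / t) of the
    alternating sum and of \<open>eta_ratio\<close>.\<close>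
  define g where "g = (\<lambda>n. exp (- pi * T n))"
  define h where "h = (\<lambda>n. exp (- pi * T n / 2))"
  define x where "x = (\<lambda>n. (u + t n * real (chi n)) / (2 * t n))"
  define E where "E = (\<lambda>n. eta_ratio (t n))"
  define G where "G = (\<lambda>n. sqrt (2 * t n) * gauss_sum (2 * t n) (x n))"
  define H where "H = (\<lambda>n. sqrt (2 * t n) * gauss_sum_alt (2 * t n) (x n))"
  define B where "B = (\<lambda>n. sw_error (q n) (exp (2 * pi * u)) n)"
  define C where "C = (\<lambda>n. cos (pi / 2 * (T n * u + real n)))"
  define X where "X = (\<lambda>n. exp (2 * pi * t n * (T n * u + real n)))"
  define P where "P = (\<lambda>n. exp (pi * t n / 2 * (T n * u + real n)\<^sup>2))"

  have tT: "0 < t n" "t n = 1 / T n" "u / t n = T n * u" "0 < T n" if "1 \<le> n" for n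
    using that by (auto simp: t_def T_def powr_minus field_simps)
  have g0: "g \<longlonglongrightarrow> 0" and h0: "h \<longlonglongrightarrow> 0"
    using a unfolding g_def h_def T_def by real_asymp+
  have ev: "\<forall>\<^sub>F n in sequentially. (1::nat) \<le> n" by (rule eventually_ge_at_top)

  have E1: "(\<lambda>n. E n - 1) \<in> O(g)"
  proof (rule bigo_eventually_le)
    show "\<forall>\<^sub>F n in sequentially. \<bar>E n - 1\<bar> \<le> 2 * (g n / (1 - g n))"
      using ev
    proof eventually_elim
      case (elim n)
      then show ?case using eta_ratio_approx[OF tT(1)[OF elim]] by (simp add: E_def g_def tT(2))
    qed
  qed (subst landau_o.big.cmult_in_iff, simp, rule bigo_geometric_ratio[OF g0])
  have G1: "(\<lambda>n. G n - 1) \<in> O(h)"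
  proof (rule bigo_eventually_le)
    show "\<forall>\<^sub>F n in sequentially. \<bar>G n - 1\<bar> \<le> 2 * (h n / (1 - h n))"
      using ev
    proof eventually_elim
      case (elim n)
      then show ?case using gauss_sum_approx[of "2 * t n" "x n"] by (simp add: G_def h_def tT)
    qed
  qed (subst landau_o.big.cmult_in_iff, simp, rule bigo_geometric_ratio[OF h0])
  have GO: "G \<in> O(\<lambda>_. 1)"
    using bigo_imp_tendsto[OF G1 h0] by (intro bigoI_tendsto[where c = 1]) auto
  have BO: "B \<in> O(\<lambda>n. exp (- 2 * pi * T n))"
    using sw_error_bigo[OF a, of u] by (simp add: B_def q_def t_def T_def)
  have BG: "(\<lambda>n. G n * B n) \<in> O(\<lambda>n. exp (- 2 * pi * T n))"
    using landau_o.big_1_mult[OF BO GO] by (simp add: mult.commute)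
  have gh: "g \<in> O(h)" using a unfolding g_def h_def T_def by real_asymp
  have Einv: "(\<lambda>n. 1 / (E n)\<^sup>2 - 1) \<in> O(g)"
    using near_one_inverse[OF near_one_mult[OF E1 E1 g0] g0] by (simp add: power2_eq_square)

  \<comment> \<open>The guard excludes \<open>n = 0\<close>, where \<open>0 powr (- a) = 0\<close>
    would make \<open>t n\<close> vanish.\<close>
  have "\<forall>n. \<exists>b. 1 \<le> n \<longrightarrow> \<bar>b\<bar> \<le> G n * B n \<and>
      SW n (- X n) (q n) = P n * sqrt (t n / 2) * exp (pi * T n / 6 - pi * t n / 6) * (G n + b) / (E n)\<^sup>2"
  proof
    fix n
    show "\<exists>b. 1 \<le> n \<longrightarrow> \<bar>b\<bar> \<le> G n * B n \<and>
      SW n (- X n) (q n) = P n * sqrt (t n / 2) * exp (pi * T n / 6 - pi * t n / 6) * (G n + b) / (E n)\<^sup>2"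
    proof (cases "1 \<le> n")
      case n: True
      have T: "pi / (6 * t n) = pi * T n / 6" using tT(2)[OF n] by simp
      show ?thesis
        using SW_core[OF tT(1)[OF n], where \<sigma> = "- 1" and n = n and u = u]
        unfolding T tT(3)[OF n] B_def G_def x_def q_def X_def P_def E_def by simp
    qed auto
  qed
  then obtain b where b: "\<And>n. 1 \<le> n \<Longrightarrow> \<bar>b n\<bar> \<le> G n * B n"
    "\<And>n. 1 \<le> n \<Longrightarrow> SW n (- X n) (q n) = P n * sqrt (t n / 2) * exp (pi * T n / 6 - pi * t n / 6) * (G n + b n) / (E n)\<^sup>2"
    by metis
  have bO: "b \<in> O(\<lambda>n. exp (- 2 * pi * T n))"
    by (rule bigo_eventually_le[OF eventually_mono[OF ev b(1)] BG])
  have bh: "b \<in> O(h)"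
    by (rule landau_o.big_trans[OF bO]) (use a in \<open>unfold h_def T_def, real_asymp\<close>)
  have r1: "(\<lambda>n. (G n + b n) * (1 / (E n)\<^sup>2) - 1) \<in> O(h)"
  proof (rule near_one_mult[OF _ _ h0])
    show "(\<lambda>n. G n + b n - 1) \<in> O(h)"
      using sum_in_bigo(1)[OF G1 bh] by (simp add: algebra_simps)
    show "(\<lambda>n. 1 / (E n)\<^sup>2 - 1) \<in> O(h)"
      by (rule landau_o.big_trans[OF Einv gh])
  qed
  show ?A
  proof (intro exI conjI allI impI)
    show "(\<lambda>n. (G n + b n) * (1 / (E n)\<^sup>2) - 1) \<in> O(\<lambda>n. exp (- pi * real n powr a / 2))"
      using r1 by (simp add: h_def T_def)
    fix n :: nat assume n: "1 \<le> n"
    have "sqrt (t n / 2) = 1 / sqrt (2 * T n)"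
      using tT(2)[OF n] by (simp add: real_sqrt_divide real_sqrt_mult)
    moreover have "exp (pi * T n / 6 - pi * t n / 6) = 1 / exp (pi * t n / 6 - pi * T n / 6)"
      by (simp add: exp_diff)
    ultimately have "SW n (- X n) (q n) = exp (pi * t n * (T n * u + real n)\<^sup>2 / 2)
        * (1 + ((G n + b n) * (1 / (E n)\<^sup>2) - 1)) / (sqrt (2 * T n) * exp (pi * t n / 6 - pi * T n / 6))"
      using b(2)[OF n] by (simp add: P_def)
    then show "SW n (- exp (2 * pi * real n powr (- a) * (real n powr a * u + real n)))
                 (exp (- 2 * pi * real n powr (- a))) =
            exp (pi * real n powr (- a) * (real n powr a * u + real n)\<^sup>2 / 2)
            * (1 + ((G n + b n) * (1 / (E n)\<^sup>2) - 1))
            / (sqrt (2 * real n powr a)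
               * exp (pi * real n powr (- a) / 6 - pi * real n powr a / 6))"
      unfolding X_def q_def t_def T_def .
  qed

  have "\<forall>n. \<exists>d. 1 \<le> n \<longrightarrow> \<bar>d\<bar> \<le> G n * B n \<and>
      SW n (X n) (q n) = (- 1) ^ (n div 2) * P n * sqrt (t n / 2) * exp (pi * T n / 6 - pi * t n / 6) * (H n + d) / (E n)\<^sup>2"
  proof
    fix n
    show "\<exists>d. 1 \<le> n \<longrightarrow> \<bar>d\<bar> \<le> G n * B n \<and>
      SW n (X n) (q n) = (- 1) ^ (n div 2) * P n * sqrt (t n / 2) * exp (pi * T n / 6 - pi * t n / 6) * (H n + d) / (E n)\<^sup>2"
    proof (cases "1 \<le> n")
      case n: True
      have T: "pi / (6 * t n) = pi * T n / 6" using tT(2)[OF n] by simp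
      show ?thesis
        using SW_core[OF tT(1)[OF n], where \<sigma> = 1 and n = n and u = u]
        unfolding T tT(3)[OF n] B_def G_def H_def x_def q_def X_def P_def E_def by simp
    qed auto
  qed
  then obtain d where d: "\<And>n. 1 \<le> n \<Longrightarrow> \<bar>d n\<bar> \<le> G n * B n"
    "\<And>n. 1 \<le> n \<Longrightarrow> SW n (X n) (q n) = (- 1) ^ (n div 2) * P n * sqrt (t n / 2) * exp (pi * T n / 6 - pi * t n / 6) * (H n + d n) / (E n)\<^sup>2"
    by metis
  \<comment> \<open>The full error relative to the cosine. Pulling the small factor exp (- pi T / 8)
    out of the main term enlarges \<open>d\<close> by its inverse, which the bound exp (- 2 pi T)
    can afford.\<close>
  define \<rho> where "\<rho> = (\<lambda>n. (- 1) ^ (n div 2) * (exp (pi * T n / 8) * (H n / 2) - cos (pi * x n) + d n * exp (pi * T n / 8) / 2))"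
  have dO: "d \<in> O(\<lambda>n. exp (- 2 * pi * T n))"
    by (rule bigo_eventually_le[OF eventually_mono[OF ev d(1)] BG])
  have "(\<lambda>n. d n * exp (pi * T n / 8)) \<in> O(\<lambda>n. exp (- 2 * pi * T n) * exp (pi * T n / 8))"
    by (rule landau_o.big.mult[OF dO landau_o.big_refl])
  also have "(\<lambda>n. exp (- 2 * pi * T n) * exp (pi * T n / 8)) \<in> O(g)"
    using a unfolding g_def T_def by real_asymp
  finally have dg: "(\<lambda>n. d n * exp (pi * T n / 8)) \<in> O(g)" .
  have Hg: "(\<lambda>n. exp (pi * T n / 8) * (H n / 2) - cos (pi * x n)) \<in> O(g)"
  proof (rule bigo_eventually_le[OF _ bigo_geometric_ratio[OF g0]])
    show "\<forall>\<^sub>F n in sequentially. \<bar>exp (pi * T n / 8) * (H n / 2) - cos (pi * x n)\<bar> \<le> g n / (1 - g n)"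
      using ev
    proof eventually_elim
      case (elim n)
      then show ?case
        using gauss_sum_alt_approx[OF tT(1)[OF elim], of "x n"] by (simp add: H_def g_def tT(2))
    qed
  qed
  have \<rho>O: "\<rho> \<in> O(g)"
  proof -
    have "(\<lambda>n. exp (pi * T n / 8) * (H n / 2) - cos (pi * x n) + d n * exp (pi * T n / 8) / 2) \<in> O(g)"
      using sum_in_bigo(1)[OF Hg, of "\<lambda>n. d n * exp (pi * T n / 8) / 2"] dg by simp
    from landau_o.big_1_mult[OF this, of "\<lambda>n. (- 1) ^ (n div 2)"] show ?thesis
      unfolding \<rho>_def by (simp add: mult.commute bigoI[where c = 1])
  qed
  have SWX: "SW n (X n) (q n) = sqrt (2 * t n) * P n * exp (pi * T n / 24 - pi * t n / 6) * ((C n + \<rho> n) * (1 / (E n)\<^sup>2))"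
    if n: "1 \<le> n" for n
  proof -
    \<comment> \<open>The sign (-1) ^ (n div 2) coming from the power of - z is a shift of the
      cosine by pi (n div 2); this combines the two parities of \<open>n\<close> into one
      formula.\<close>
    have half: "real n = 2 * real (n div 2) + real (chi n)" using div_2_chi(1)[of n] by linarith
    have "x n = (T n * u + real (chi n)) / 2"
      unfolding x_def tT(3)[OF n, symmetric] using tT(1)[OF n] by (simp add: field_simps)
    then have "pi / 2 * (T n * u + real n) = pi * x n + pi * real (n div 2)"
      by (subst half) (simp add: algebra_simps add_divide_distrib)
    then have "C n = (- 1) ^ (n div 2) * cos (pi * x n)"
      unfolding C_def by (simp only: cos_add_npi)
    then have "C n + \<rho> n = (- 1) ^ (n div 2) * (exp (pi * T n / 8) / 2) * (H n + d n)"
      unfolding \<rho>_def by (simp add: algebra_simps add_divide_distrib)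
    moreover have "exp (pi * T n / 6 - pi * t n / 6) = exp (pi * T n / 24 - pi * t n / 6) * exp (pi * T n / 8)"
      by (simp flip: exp_add)
    moreover have "sqrt (2 * t n) = 2 * sqrt (t n / 2)"
      using tT(1)[OF n] by (simp add: real_sqrt_mult real_sqrt_divide field_simps)
    ultimately show ?thesis using d(2)[OF n] by simp
  qed
  define r2 where "r2 = (\<lambda>n. (C n + \<rho> n) * (1 / (E n)\<^sup>2) - C n)"
  have C1: "\<bar>C n\<bar> \<le> 1" for n by (simp add: C_def)
  have r2: "r2 \<in> O(g)"
    unfolding r2_def by (rule near_one_perturb[OF Einv \<rho>O g0 C1])
  show ?B
  proof (intro exI conjI allI impI)
    show "r2 \<in> O(\<lambda>n. exp (- pi * real n powr a))"
      using r2 by (simp add: g_def T_def)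
    fix n :: nat assume n: "1 \<le> n"
    have "sqrt (2 * t n) = sqrt (2 / T n)" using tT(2)[OF n] by simp
    moreover have "exp (pi * T n / 24 - pi * t n / 6) = 1 / exp (pi * t n / 6 - pi * T n / 24)"
      by (simp add: exp_diff)
    ultimately have "SW n (X n) (q n) = sqrt (2 / T n) * (P n * (C n + r2 n) / exp (pi * t n / 6 - pi * T n / 24))"
      using SWX[OF n] by (simp add: r2_def mult_ac)
    then show "SW n (exp (2 * pi * real n powr (- a) * (real n powr a * u + real n)))
                 (exp (- 2 * pi * real n powr (- a))) =
            sqrt (2 / real n powr a)
            * (exp (pi * real n powr (- a) / 2 * (real n powr a * u + real n)\<^sup>2)
               * (cos (pi / 2 * (real n powr a * u + real n)) + r2 n)
               / exp (pi * real n powr (- a) / 6 - pi * real n powr a / 24))"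
      unfolding X_def q_def t_def T_def P_def C_def .
  qed

  define V where "V = (\<lambda>n. qpoch (q n) (q n) n / qpoch_inf (q n) (q n))"
  \<comment> \<open>The factor left over by \<open>sw_fun_prefactor\<close>. \<open>1 / V n\<close>
    is estimated first and then inverted.\<close>
  define \<kappa> where "\<kappa> = (\<lambda>n. sqrt (E n * V n))"
  have q01: "0 < q n" "q n < 1" if "1 \<le> n" for n using tT(1)[OF that] by (auto simp: q_def)
  have "(\<lambda>n. 1 / V n - 1) \<in> O(g)"
  proof (rule bigo_eventually_le)
    show "\<forall>\<^sub>F n in sequentially. \<bar>1 / V n - 1\<bar> \<le> B n"
      using ev
    proof eventually_elim
      case (elim n)
      have "\<bar>1 / V n - 1\<bar> \<le> q n powr (real n / 4) / (1 - q n)"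
        using qpoch_ratio_bound[OF q01[OF elim], of n] by (simp add: V_def)
      also have "\<dots> \<le> B n"
      proof -
        have "0 \<le> q n powr (real n / 4) / (1 - q n)" using q01[OF elim] by simp
        moreover have "0 \<le> exp (2 * pi * u) ^ (n div 4) * q n powi (int (n div 4) ^ 2 - int (chi n) * int (n div 4))"
          "0 \<le> q n ^ ((n div 4)\<^sup>2 + chi n * (n div 4)) / exp (2 * pi * u) ^ (n div 4)"
          using q01[OF elim] by auto
        ultimately show ?thesis unfolding B_def sw_error_def by linarith
      qed
      finally show ?case .
    qed
    show "B \<in> O(g)"
      by (rule landau_o.big_trans[OF BO]) (use a in \<open>unfold g_def T_def, real_asymp\<close>)
  qed
  from near_one_inverse[OF this g0] have V1: "(\<lambda>n. V n - 1) \<in> O(g)" by simp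
  have \<kappa>1: "(\<lambda>n. \<kappa> n - 1) \<in> O(g)"
    unfolding \<kappa>_def
  proof (rule near_one_sqrt[OF near_one_mult[OF E1 V1 g0]])
    show "\<forall>\<^sub>F n in sequentially. 0 \<le> E n * V n"
      using ev
    proof eventually_elim
      case (elim n)
      then show ?case
        using eta_ratio_pos[OF tT(1)[OF elim]] qpoch_pos[OF q01[OF elim], of n] qpoch_inf_pos[OF q01[OF elim]]
        by (simp add: E_def V_def)
    qed
  qed
  show ?C
  proof (intro exI conjI allI impI)
    show "(\<lambda>n. (C n + r2 n) * \<kappa> n - C n) \<in> O(\<lambda>n. exp (- pi * real n powr a))"
      using near_one_perturb[OF \<kappa>1 r2 g0 C1] by (simp add: g_def T_def)
    fix n :: nat assume n: "1 \<le> n"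
    have tn: "t n * real n = real n powr (1 - a)"
      using n by (simp add: t_def powr_minus powr_diff field_simps)
    have T: "pi / (24 * t n) = pi * T n / 24" using tT(2)[OF n] by simp
    have "sw_fun n (X n) (q n) = sqrt (q n ^ n * qpoch (q n) (q n) n * w_sw (X n) (q n))
       * (sqrt (2 * t n) * P n * exp (pi * T n / 24 - pi * t n / 6)) * (C n + r2 n)"
      unfolding sw_fun_def SWX[OF n] by (simp add: r2_def)
    also have "sqrt (q n ^ n * qpoch (q n) (q n) n * w_sw (X n) (q n))
       * (sqrt (2 * t n) * P n * exp (pi * T n / 24 - pi * t n / 6)) =
       \<kappa> n * exp (- pi * u / 2) / (sqrt pi * exp (3 * pi * real n powr (1 - a) / 2 + pi * t n / 4))"
      using sw_fun_prefactor[OF tT(1)[OF n], of n u] unfolding tT(3)[OF n] T tn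
      by (simp only: X_def P_def q_def \<kappa>_def E_def V_def)
    finally have "sw_fun n (X n) (q n) = exp (- pi * u / 2) * (C n + ((C n + r2 n) * \<kappa> n - C n))
       / (sqrt pi * exp (3 * pi * real n powr (1 - a) / 2 + pi * t n / 4))"
      by (simp add: mult_ac)
    then show "sw_fun n (exp (2 * pi * real n powr (- a) * (real n powr a * u + real n)))
                     (exp (- 2 * pi * real n powr (- a))) =
            exp (- pi * u / 2)
            * (cos (pi / 2 * (real n powr a * u + real n)) + ((C n + r2 n) * \<kappa> n - C n))
            / (sqrt pi
               * exp (3 * pi * real n powr (1 - a) / 2 + pi * real n powr (- a) / 4))"
      unfolding X_def q_def t_def T_def C_def .
  qed
qed

text \<open>The prefactor in the defining equation is nonzero, so \<open>e n\<close> is exactly the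
  difference bounded in \<open>SW_theta_error\<close>. The coefficients 2, 1, 1 of
  \<open>sw_error\<close> are all at most 12.\<close>

lemma SW_theta_error_cmod:
  fixes q :: real and z :: complex and e :: "nat \<Rightarrow> complex"
  assumes q: "0 < q" "q < 1" and z: "z \<noteq> 0"
    and e: "\<And>n. SW n (z * of_real (q powi (- int n))) q =
             (- z) ^ (n div 2) * (theta4 (inverse z * of_real (q ^ chi n)) q + e n)
             / of_real ((qpoch_inf q q)\<^sup>2 * q ^ ((n div 2) * ((n + 1) div 2)))"
  shows "cmod (e n) \<le>
           12 * theta3 (inverse (cmod z) * q ^ chi n) q *
           (q powr (real n / 4) / (1 - q)
            + cmod z ^ (n div 4) * q powi (int (n div 4) ^ 2 - int (chi n) * int (n div 4))
            + q ^ ((n div 4)\<^sup>2 + chi n * (n div 4)) / cmod z ^ (n div 4))"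
proof -
  define \<theta> where "\<theta> = theta3 (inverse (cmod z) * q ^ chi n) q"
  have "p * (th + e') / d * d / p - th = e'" if "p \<noteq> 0" "d \<noteq> 0" for p th e' d :: complex
    using that by simp
  then have "SW n (z * of_real (q powi (- int n))) q
      * of_real ((qpoch_inf q q)\<^sup>2 * q ^ ((n div 2) * ((n + 1) div 2))) / (- z) ^ (n div 2)
      - theta4 (inverse z * of_real (q ^ chi n)) q = e n"
    unfolding e[of n] using q z qpoch_inf_pos[OF q] by simp
  with SW_theta_error[OF q z, of n] have "cmod (e n) \<le> \<theta> * sw_error q (cmod z) n"
    by (simp add: \<theta>_def)
  moreover have "0 \<le> \<theta>"
    unfolding \<theta>_def by (rule has_sum_nonneg[OF has_sum_norm_sw_term[OF q z]]) simp
  then have "\<theta> * sw_error q (cmod z) n \<le> \<theta> * (12 * (q powr (real n / 4) / (1 - q)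
            + cmod z ^ (n div 4) * q powi (int (n div 4) ^ 2 - int (chi n) * int (n div 4))
            + q ^ ((n div 4)\<^sup>2 + chi n * (n div 4)) / cmod z ^ (n div 4)))"
  proof (rule mult_left_mono[rotated])
    have "0 \<le> q powr (real n / 4) / (1 - q)"
      "0 \<le> cmod z ^ (n div 4) * q powi (int (n div 4) ^ 2 - int (chi n) * int (n div 4))"
      "0 \<le> q ^ ((n div 4)\<^sup>2 + chi n * (n div 4)) / cmod z ^ (n div 4)"
      using q by auto
    then show "sw_error q (cmod z) n \<le> 12 * (q powr (real n / 4) / (1 - q)
            + cmod z ^ (n div 4) * q powi (int (n div 4) ^ 2 - int (chi n) * int (n div 4))
            + q ^ ((n div 4)\<^sup>2 + chi n * (n div 4)) / cmod z ^ (n div 4))"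
      unfolding sw_error_def distrib_left by linarith
  qed
  ultimately show ?thesis unfolding \<theta>_def[symmetric] by (simp only: mult_ac)
qed

theorem theorem2p5:
  "(\<forall>(q::real) (z::complex) (e::nat \<Rightarrow> complex).
      0 < q \<and> q < 1 \<and> z \<noteq> 0 \<and>
      (\<forall>n. SW n (z * of_real (q powi (- int n))) q =
             (- z) ^ (n div 2) * (theta4 (inverse z * of_real (q ^ chi n)) q + e n)
             / of_real ((qpoch_inf q q)\<^sup>2 * q ^ ((n div 2) * ((n + 1) div 2))))
      \<longrightarrow>
      (\<forall>\<^sub>F n in sequentially.
         cmod (e n) \<le>
           12 * theta3 (inverse (cmod z) * q ^ chi n) q *
           (q powr (real n / 4) / (1 - q)
            + cmod z ^ (n div 4) * q powi (int (n div 4) ^ 2 - int (chi n) * int (n div 4))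
            + q ^ ((n div 4)\<^sup>2 + chi n * (n div 4)) / cmod z ^ (n div 4))))
   \<and>
   (\<forall>(a::real) (u::real).
      0 < a \<and> a < 1 / 2 \<longrightarrow>
      (\<exists>r. r \<in> O(\<lambda>n. exp (- pi * real n powr a / 2)) \<and>
         (\<forall>n\<ge>1.
            SW n (- exp (2 * pi * real n powr (- a) * (real n powr a * u + real n)))
                 (exp (- 2 * pi * real n powr (- a))) =
            exp (pi * real n powr (- a) * (real n powr a * u + real n)\<^sup>2 / 2) * (1 + r n)
            / (sqrt (2 * real n powr a)
               * exp (pi * real n powr (- a) / 6 - pi * real n powr a / 6))))
      \<and>
      (\<exists>r. r \<in> O(\<lambda>n. exp (- pi * real n powr a)) \<and>
         (\<forall>n\<ge>1.
            SW n (exp (2 * pi * real n powr (- a) * (real n powr a * u + real n)))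
                 (exp (- 2 * pi * real n powr (- a))) =
            sqrt (2 / real n powr a)
            * (exp (pi * real n powr (- a) / 2 * (real n powr a * u + real n)\<^sup>2)
               * (cos (pi / 2 * (real n powr a * u + real n)) + r n)
               / exp (pi * real n powr (- a) / 6 - pi * real n powr a / 24))))
      \<and>
      (\<exists>r. r \<in> O(\<lambda>n. exp (- pi * real n powr a)) \<and>
         (\<forall>n\<ge>1.
            sw_fun n (exp (2 * pi * real n powr (- a) * (real n powr a * u + real n)))
                     (exp (- 2 * pi * real n powr (- a))) =
            exp (- pi * u / 2)
            * (cos (pi / 2 * (real n powr a * u + real n)) + r n)
            / (sqrt pi
               * exp (3 * pi * real n powr (1 - a) / 2 + pi * real n powr (- a) / 4)))))"
proof (intro conjI allI impI, goal_cases)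
  case (1 q z e)
  then show ?case
    by (intro always_eventually allI SW_theta_error_cmod) auto
next
  case (2 a u)
  then show ?case by (intro SW_asymptotics(1)) auto
next
  case (3 a u)
  then show ?case by (intro SW_asymptotics(2)) auto
next
  case (4 a u)
  then show ?case by (intro SW_asymptotics(3)) auto
qed

end
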